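(* The derivability problem for $\mathbf{CommACT}$, that is, the set of all sequents derivable in the calculus $\mathbf{CommACT}$, is $\Sigma_1^0$-complete (it is recursively enumerable, and every recursively enumerable set is many-one reducible to it).
   Context: Formulae are built from a countable set of variables $\mathrm{Var}$ and constants $\mathbf{0},\mathbf{1}$ using binary connectives $\multimap,\cdot,\vee,\wedge$ and the unary connective ${}^*$. A sequent is an expression $\Gamma\vdash A$, where $\Gamma$ is a finite multiset of formulae (possibly empty) and $A$ is a formula. Sequents are encoded by natural numbers in a standard computable way. The calculus $\mathbf{CommACT}$ has the following axioms and rules. Axioms: $A\vdash A$; $\Gamma,\mathbf{0}\vdash C$; $\vdash\mathbf{1}$. Rules: ($\mathbf{1}L$) from $\Gamma\vdash C$ infer $\Gamma,\mathbf{1}\vdash C$; ($\multimap L$) from $\Pi\vdash A$ and $\Gamma,B\vdash C$ infer $\Gamma,\Pi,A\multimap B\vdash C$; ($\multimap R$) from $A,\Pi\vdash B$ infer $\Pi\vdash A\multimap B$; ($\cdot L$) from $\Gamma,A,B\vdash C$ infer $\Gamma,A\cdot B\vdash C$; ($\cdot R$) from $\Pi\vdash A$ and $\Delta\vdash B$ infer $\Pi,\Delta\vdash A\cdot B$; ($\vee L$) from $\Gamma,A\vdash C$ and $\Gamma,B\vdash C$ infer $\Gamma,A\vee B\vdash C$; ($\vee R$) from $\Pi\vdash A$ infer $\Pi\vdash A\vee B$; from $\Pi\vdash B$ infer $\Pi\vdash A\vee B$; ($\wedge L$) from $\Gamma,A\vdash C$ infer $\Gamma,A\wedge B\vdash C$;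 from $\Gamma,B\vdash C$ infer $\Gamma,A\wedge B\vdash C$; ($\wedge R$) from $\Pi\vdash A$ and $\Pi\vdash B$ infer $\Pi\vdash A\wedge B$; (Cut) from $\Pi\vdash A$ and $\Gamma,A\vdash C$ infer $\Gamma,\Pi\vdash C$; and for Kleene star: axioms $\vdash A^*$ and $A,A^*\vdash A^*$, and the rule: from $\vdash B$ and $A,B\vdash B$ infer $A^*\vdash B$. Derivations are finite. *)

theory Defs
  imports Main "HOL-Library.Multiset" "HOL-Library.Nat_Bijection"
begin

section \<open>Partial recursive functions\<close>

text \<open>
  Terms carry no arities: on argument lists of any fixed length, a term denotes a partial
  recursive function of that many arguments, which is undefined wherever arities do not match.
\<close>

datatype recf =
    Zero
  | Succ
  | Proj nat
  | Comp recf "recf list"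
  | PrimRec recf recf
  | Mu recf

inductive rec_eval :: "recf \<Rightarrow> nat list \<Rightarrow> nat \<Rightarrow> bool" where
  rec_Zero: "rec_eval Zero xs 0"
| rec_Succ: "rec_eval Succ [x] (Suc x)"
| rec_Proj: "i < length xs \<Longrightarrow> rec_eval (Proj i) xs (xs ! i)"
| rec_Comp: "list_all2 (\<lambda>g y. rec_eval g xs y) gs ys \<Longrightarrow> rec_eval f ys z \<Longrightarrow>
    rec_eval (Comp f gs) xs z"
| rec_PrimRec_0: "rec_eval f xs y \<Longrightarrow> rec_eval (PrimRec f g) (0 # xs) y"
| rec_PrimRec_Suc: "rec_eval (PrimRec f g) (n # xs) y \<Longrightarrow> rec_eval g (n # y # xs) z \<Longrightarrow>
    rec_eval (PrimRec f g) (Suc n # xs) z"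
| rec_Mu: "rec_eval f (n # xs) 0 \<Longrightarrow> \<forall>m<n. \<exists>y. rec_eval f (m # xs) (Suc y) \<Longrightarrow>
    rec_eval (Mu f) xs n"

inductive_cases rec_ZeroE: "rec_eval Zero xs y"
  and rec_SuccE: "rec_eval Succ xs y"
  and rec_ProjE: "rec_eval (Proj i) xs y"
  and rec_CompE: "rec_eval (Comp f gs) xs y"
  and rec_PrimRec_0E: "rec_eval (PrimRec f g) (0 # xs) y"
  and rec_PrimRec_SucE: "rec_eval (PrimRec f g) (Suc n # xs) y"
  and rec_MuE: "rec_eval (Mu f) xs y"

lemma rec_eval_deterministic:
  "rec_eval f xs y \<Longrightarrow> rec_eval f xs z \<Longrightarrow> y = z"
proof (induction arbitrary: z rule: rec_eval.induct)
  case (rec_Zero xs)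
  then show ?case by (rule rec_ZeroE) simp
next
  case (rec_Succ x)
  then show ?case by (rule rec_SuccE) simp
next
  case (rec_Proj i xs)
  from rec_Proj.prems show ?case by (rule rec_ProjE) simp
next
  case (rec_Comp xs gs ys f w)
  from rec_Comp.prems show ?case
  proof (rule rec_CompE)
    fix ys'
    assume ys': "list_all2 (\<lambda>g y. rec_eval g xs y) gs ys'" "rec_eval f ys' z"
    have "ys = ys'"
    proof (rule nth_equalityI)
      show "length ys = length ys'"
        using rec_Comp.IH(1) ys'(1) by (simp add: list_all2_lengthD[symmetric])
    next
      fix i assume "i < length ys"
      then show "ys ! i = ys' ! i"
        using rec_Comp.IH(1) ys'(1) by (simp add: list_all2_conv_all_nth)
    qed
    then show "w = z" using rec_Comp.IH(2) ys'(2) by blast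
  qed
next
  case (rec_PrimRec_0 f xs y g)
  from rec_PrimRec_0.prems show ?case by (rule rec_PrimRec_0E) (rule rec_PrimRec_0.IH)
next
  case (rec_PrimRec_Suc f g n xs y w)
  from rec_PrimRec_Suc.prems show ?case
  proof (rule rec_PrimRec_SucE)
    fix y' assume y': "rec_eval (PrimRec f g) (n # xs) y'" "rec_eval g (n # y' # xs) z"
    have "y = y'" using y'(1) by (rule rec_PrimRec_Suc.IH(1))
    then show "w = z" using y'(2) rec_PrimRec_Suc.IH(2) by simp
  qed
next
  case (rec_Mu f n xs)
  from rec_Mu.prems show ?case
  proof (rule rec_MuE)
    assume 0: "rec_eval f (z # xs) 0" and Suc: "\<forall>m<z. \<exists>y. rec_eval f (m # xs) (Suc y)"
    have "\<not> z < n" using rec_Mu.IH(2) 0 by blast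
    moreover have "\<not> n < z" using rec_Mu.IH(1) Suc by blast
    ultimately show "n = z" by simp
  qed
qed

definition computable :: "(nat \<Rightarrow> nat) \<Rightarrow> bool" where
  "computable h \<longleftrightarrow> (\<exists>f. \<forall>x. rec_eval f [x] (h x))"

definition recursively_enumerable :: "nat set \<Rightarrow> bool" where
  "recursively_enumerable A \<longleftrightarrow> (\<exists>f. \<forall>x. x \<in> A \<longleftrightarrow> (\<exists>y. rec_eval f [x] y))"

definition many_one_reducible :: "nat set \<Rightarrow> nat set \<Rightarrow> bool" where
  "many_one_reducible A B \<longleftrightarrow> (\<exists>h. computable h \<and> (\<forall>x. x \<in> A \<longleftrightarrow> h x \<in> B))"

definition Sigma01_complete :: "nat set \<Rightarrow> bool" where
  "Sigma01_complete A \<longleftrightarrow>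
    recursively_enumerable A \<and> (\<forall>B. recursively_enumerable B \<longrightarrow> many_one_reducible B A)"

section \<open>The calculus CommACT\<close>

datatype form =
    Var nat
  | Bot
  | One
  | Imp form form
  | Tens form form
  | Or form form
  | And form form
  | Star form

type_synonym sequent = "form multiset \<times> form"

inductive derivable :: "form multiset \<Rightarrow> form \<Rightarrow> bool"  (infix \<open>\<turnstile>\<close> 45) where
  Ax: "{#A#} \<turnstile> A"
| BotL: "add_mset Bot \<Gamma> \<turnstile> C"
| OneR: "{#} \<turnstile> One"
| OneL: "\<Gamma> \<turnstile> C \<Longrightarrow> add_mset One \<Gamma> \<turnstile> C"
| ImpL: "\<Pi> \<turnstile> A \<Longrightarrow> add_mset B \<Gamma> \<turnstile> C \<Longrightarrow> add_mset (Imp A B) (\<Gamma> + \<Pi>) \<turnstile> C"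
| ImpR: "add_mset A \<Pi> \<turnstile> B \<Longrightarrow> \<Pi> \<turnstile> Imp A B"
| TensL: "add_mset A (add_mset B \<Gamma>) \<turnstile> C \<Longrightarrow> add_mset (Tens A B) \<Gamma> \<turnstile> C"
| TensR: "\<Pi> \<turnstile> A \<Longrightarrow> \<Delta> \<turnstile> B \<Longrightarrow> \<Pi> + \<Delta> \<turnstile> Tens A B"
| OrL: "add_mset A \<Gamma> \<turnstile> C \<Longrightarrow> add_mset B \<Gamma> \<turnstile> C \<Longrightarrow> add_mset (Or A B) \<Gamma> \<turnstile> C"
| OrR1: "\<Pi> \<turnstile> A \<Longrightarrow> \<Pi> \<turnstile> Or A B"
| OrR2: "\<Pi> \<turnstile> B \<Longrightarrow> \<Pi> \<turnstile> Or A B"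
| AndL1: "add_mset A \<Gamma> \<turnstile> C \<Longrightarrow> add_mset (And A B) \<Gamma> \<turnstile> C"
| AndL2: "add_mset B \<Gamma> \<turnstile> C \<Longrightarrow> add_mset (And A B) \<Gamma> \<turnstile> C"
| AndR: "\<Pi> \<turnstile> A \<Longrightarrow> \<Pi> \<turnstile> B \<Longrightarrow> \<Pi> \<turnstile> And A B"
| Cut: "\<Pi> \<turnstile> A \<Longrightarrow> add_mset A \<Gamma> \<turnstile> C \<Longrightarrow> \<Gamma> + \<Pi> \<turnstile> C"
| Star_0: "{#} \<turnstile> Star A"
| Star_Suc: "{#A, Star A#} \<turnstile> Star A"
| Star_ind: "{#} \<turnstile> B \<Longrightarrow> {#A, B#} \<turnstile> B \<Longrightarrow> {#Star A#} \<turnstile> B"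

section \<open>Coding of sequents\<close>

primrec form_code :: "form \<Rightarrow> nat" where
  "form_code (Var n) = prod_encode (0, n)"
| "form_code Bot = prod_encode (1, 0)"
| "form_code One = prod_encode (2, 0)"
| "form_code (Imp A B) = prod_encode (3, prod_encode (form_code A, form_code B))"
| "form_code (Tens A B) = prod_encode (4, prod_encode (form_code A, form_code B))"
| "form_code (Or A B) = prod_encode (5, prod_encode (form_code A, form_code B))"
| "form_code (And A B) = prod_encode (6, prod_encode (form_code A, form_code B))"
| "form_code (Star A) = prod_encode (7, form_code A)"

text \<open>
  Sorting the codes of the antecedent picks one list representing the multiset, so that every
  sequent has exactly one code.
\<close>

definition sequent_code :: "sequent \<Rightarrow> nat" where
  "sequent_code = (\<lambda>(\<Gamma>, A).
    prod_encode (list_encode (sorted_list_of_multiset (image_mset form_code \<Gamma>)), form_code A))"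

lemma form_code_inject: "form_code A = form_code B \<longleftrightarrow> A = B"
proof (induction A arbitrary: B)
  case (Var n) show ?case by (cases B) simp_all
next
  case Bot show ?case by (cases B) simp_all
next
  case One show ?case by (cases B) simp_all
next
  case (Imp A1 A2) then show ?case by (cases B) simp_all
next
  case (Tens A1 A2) then show ?case by (cases B) simp_all
next
  case (Or A1 A2) then show ?case by (cases B) simp_all
next
  case (And A1 A2) then show ?case by (cases B) simp_all
next
  case (Star A) then show ?case by (cases B) simp_all
qed

lemma inj_sequent_code: "inj sequent_code"
proof (rule injI)
  fix s t :: sequent
  assume eq: "sequent_code s = sequent_code t"
  obtain \<Gamma> A \<Delta> B where st: "s = (\<Gamma>, A)" "t = (\<Delta>, B)" by (metis surj_pair)
  have "sorted_list_of_multiset (image_mset form_code \<Gamma>)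
      = sorted_list_of_multiset (image_mset form_code \<Delta>)"
    using eq by (simp add: sequent_code_def st list_encode_eq)
  then have "image_mset form_code \<Gamma> = image_mset form_code \<Delta>"
    by (metis mset_sorted_list_of_multiset)
  moreover have "inj (image_mset form_code)"
    by (rule multiset.inj_map) (simp add: inj_def form_code_inject)
  ultimately have "\<Gamma> = \<Delta>" by (rule injD[rotated])
  then show "s = t" using eq by (simp add: sequent_code_def st form_code_inject)
qed

definition CommACT_theorems :: "sequent set" where
  "CommACT_theorems = {(\<Gamma>, A). \<Gamma> \<turnstile> A}"

end

theory Submission
  imports Defs "HOL-Library.Product_Plus" "HOL-Library.Countable"
begin

text \<open>
  Enumerability: CommACT is equivalent to an order \<open>\<preceq>\<close> on formulas, generated by finitely many
  rules that act on codes as computable functions, so its graph is the range of a computable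
  function.

  Hardness: a register machine is encoded by a formula \<open>E\<close> whose conjuncts are its instructions, a
  zero test being a disjunction whose second branch is derivable only if the register is empty. The
  sequent \<open>E\<^sup>*, C \<turnstile> G\<close> then says that the machine makes any number of steps from \<open>C\<close>. It is
  derivable if the machine runs into a loop, for the finitely many configurations of the loop
  form an invariant to which the induction rule applies, and by phase semantics it is not derivable
  if the machine halts. For machines that do neither, self-reference decides. Given an enumerable set
  \<open>B\<close> and an input \<open>x\<close>, the machine searches simultaneously for a proof of its own sequent, in which
  case it halts, and for a witness of \<open>x \<in> B\<close>, in which case it loops. As it cannot halt
  without refuting the proof found, its sequent is derivable exactly if \<open>x \<in> B\<close>. It knows its own
  sequent because the code of its formula is part of its input.
\<close>

section \<open>Computable functions\<close>

text \<open>Read with the omega-rule, the sequent would say exactly that the machine never halts,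
  which is in general not an enumerable property. The finitary induction rule asks for an invariant
  that can be written as a formula, so derivability lies somewhere between looping and not halting.
  The only grip on it is that it is enumerable and separates these two extremes. Looping and halting
  are effectively inseparable, and every enumerable set that separates such a pair is complete; the
  final argument is the proof of this fact, carried out for the machines at hand. The phase model
  validates the omega-rule, which is why soundness refutes the sequents of all halting machines at
  once. A multiset antecedent can hold unary registers but cannot observe that a resource is absent;
  this obstacle shapes the zero test and the choice of the model.\<close>

definition total_recf :: "nat \<Rightarrow> (nat list \<Rightarrow> nat) \<Rightarrow> bool" where
  "total_recf n f \<longleftrightarrow> (\<exists>r. \<forall>xs. length xs = n \<longrightarrow> rec_eval r xs (f xs))"

lemma total_cong:
  "total_recf n f \<Longrightarrow> (\<And>xs. length xs = n \<Longrightarrow> f xs = g xs) \<Longrightarrow> total_recf n g"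
  unfolding total_recf_def by metis

lemma total_proj: "i < n \<Longrightarrow> total_recf n (\<lambda>xs. xs ! i)"
  unfolding total_recf_def by (rule exI[of _ "Proj i"]) (auto intro: rec_Proj)

lemma total_comp:
  assumes F: "total_recf (length fs) F" and fs: "\<And>f. f \<in> set fs \<Longrightarrow> total_recf n f"
  shows "total_recf n (\<lambda>xs. F (map (\<lambda>f. f xs) fs))"
proof -
  obtain r where r: "\<And>ys. length ys = length fs \<Longrightarrow> rec_eval r ys (F ys)"
    using F unfolding total_recf_def by blast
  have "\<exists>gs. length gs = length fs \<and>
    (\<forall>i<length fs. \<forall>xs. length xs = n \<longrightarrow> rec_eval (gs ! i) xs ((fs ! i) xs))"
    using fs unfolding total_recf_def
    by (intro Skolem_list_nth[THEN iffD1, simplified conj_commute] allI impI) (metis nth_mem)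
  then obtain gs where gs: "length gs = length fs"
    "\<And>i xs. i < length fs \<Longrightarrow> length xs = n \<Longrightarrow> rec_eval (gs ! i) xs ((fs ! i) xs)" by blast
  show ?thesis
    unfolding total_recf_def
    by (rule exI[of _ "Comp r gs"]) (auto intro!: rec_Comp r simp: list_all2_conv_all_nth gs)
qed

lemma total_comp1:
  assumes "computable F" "total_recf n f"
  shows "total_recf n (\<lambda>xs. F (f xs))"
proof -
  have "total_recf 1 (\<lambda>ys. F (ys ! 0))"
    using assms(1) unfolding total_recf_def computable_def
    by (metis One_nat_def length_0_conv length_Suc_conv nth_Cons_0)
  then have "total_recf (length [f]) (\<lambda>ys. F (ys ! 0))" by simp
  from total_comp[OF this, of n] show ?thesis using assms(2) by simp
qed

lemma total_comp2:
  assumes "total_recf 2 (\<lambda>ys. F (ys ! 0) (ys ! 1))" "total_recf n f" "total_recf n g"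
  shows "total_recf n (\<lambda>xs. F (f xs) (g xs))"
  using total_comp[of "[f, g]", OF _ , of "\<lambda>ys. F (ys ! 0) (ys ! 1)" n] assms
  by (auto simp: numeral_2_eq_2)

lemma total_const: "total_recf n (\<lambda>_. c)"
proof (induction c)
  case 0
  show ?case unfolding total_recf_def using rec_Zero by blast
next
  case (Suc c)
  have "computable Suc" unfolding computable_def using rec_Succ by blast
  from total_comp1[OF this Suc] show ?case .
qed

lemma total_prim_rec:
  assumes f: "total_recf n f" and g: "total_recf (Suc (Suc n)) g"
  shows "total_recf (Suc n) (\<lambda>xs. rec_nat (f (tl xs)) (\<lambda>i y. g (i # y # tl xs)) (hd xs))"
proof -
  obtain r where r: "\<And>ys. length ys = n \<Longrightarrow> rec_eval r ys (f ys)"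
    using f unfolding total_recf_def by blast
  obtain s where s: "\<And>ys. length ys = Suc (Suc n) \<Longrightarrow> rec_eval s ys (g ys)"
    using g unfolding total_recf_def by blast
  have "rec_eval (PrimRec r s) (k # xs) (rec_nat (f xs) (\<lambda>i y. g (i # y # xs)) k)"
    if "length xs = n" for k xs
    by (induction k) (auto intro!: rec_PrimRec_0 rec_PrimRec_Suc r s that)
  then show ?thesis
    unfolding total_recf_def
    by (intro exI[of _ "PrimRec r s"] allI impI) (metis length_Suc_conv list.sel(1,3))
qed

text \<open>The bridge from argument lists, which primitive recursion requires because it passes a
  counter and an accumulator, to the unary functions in which the later closure rules are
  phrased.\<close>

lemma computable_iff_total: "computable F \<longleftrightarrow> total_recf 1 (\<lambda>xs. F (xs ! 0))"
proof
  assume "computable F" then show "total_recf 1 (\<lambda>xs. F (xs ! 0))"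
    by (rule total_comp1) (rule total_proj, simp)
next
  assume "total_recf 1 (\<lambda>xs. F (xs ! 0))"
  then obtain r where "\<And>xs. length xs = 1 \<Longrightarrow> rec_eval r xs (F (xs ! 0))" 
    unfolding total_recf_def by blast
  from this[of "[_]"] show "computable F" unfolding computable_def by auto
qed

section \<open>Closure rules for computable functions\<close>

named_theorems comp_intros

lemma computable_id: "computable (\<lambda>x. x)"
  by (simp add: computable_iff_total total_proj)

lemma computable_const [comp_intros]: "computable (\<lambda>_. c)"
  by (simp add: computable_iff_total total_const)

lemma computable_compose: "computable F \<Longrightarrow> computable f \<Longrightarrow> computable (\<lambda>x. F (f x))"
  using total_comp1[of F 1 "\<lambda>xs. f (xs ! 0)"] by (simp add: computable_iff_total[of f] computable_iff_total[of "\<lambda>x. F (f x)"])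

lemma computable_compose2:
  "total_recf 2 (\<lambda>ys. F (ys ! 0) (ys ! 1)) \<Longrightarrow> computable f \<Longrightarrow> computable g \<Longrightarrow> computable (\<lambda>x. F (f x) (g x))"
  using total_comp2[of F 1 "\<lambda>xs. f (xs ! 0)" "\<lambda>xs. g (xs ! 0)"] by (simp add: computable_iff_total)

lemma computable_Suc [comp_intros]: "computable f \<Longrightarrow> computable (\<lambda>x. Suc (f x))"
  by (rule computable_compose[of Suc]) (auto simp: computable_def intro: rec_Succ)

lemma length_2_conv: "length xs = 2 \<longleftrightarrow> (\<exists>x y. xs = [x, y])"
  by (auto simp: numeral_2_eq_2 length_Suc_conv)

lemma total_add: "total_recf 2 (\<lambda>ys. ys ! 0 + ys ! 1)"
proof -
  have "total_recf 3 (\<lambda>ys. Suc (ys ! 1))"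
    by (rule total_comp1) (auto intro: comp_intros computable_id total_proj)
  then have "total_recf 2 (\<lambda>xs. rec_nat (tl xs ! 0) (\<lambda>i y. Suc ((i # y # tl xs) ! 1)) (hd xs))"
    using total_prim_rec[OF total_proj[of 0 1], of "\<lambda>ys. Suc (ys ! 1)"]
    by (simp add: numeral_2_eq_2 numeral_3_eq_3)
  moreover have "rec_nat y (\<lambda>i. Suc) x = x + y" for x y by (induction x) auto
  ultimately show ?thesis by (elim total_cong) (auto simp: length_2_conv)
qed

lemma computable_pred: "computable (\<lambda>x. x - 1)"
proof -
  have "total_recf 1 (\<lambda>xs. rec_nat 0 (\<lambda>i y. (i # y # tl xs) ! 0) (hd xs))"
    using total_prim_rec[OF total_const[of 0 0], of "\<lambda>ys. ys ! 0"] total_proj[of 0 2]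
    by (simp add: numeral_2_eq_2)
  moreover have "rec_nat 0 (\<lambda>i y. i) x = x - 1" for x :: nat by (cases x) auto
  ultimately show ?thesis unfolding computable_iff_total
    by (elim total_cong) (auto simp: length_Suc_conv)
qed

lemma total_diff: "total_recf 2 (\<lambda>ys. ys ! 0 - ys ! 1)"
proof -
  have "total_recf 3 (\<lambda>ys. ys ! 1 - 1)"
    by (rule total_comp1[OF computable_pred]) (auto intro: total_proj)
  then have "total_recf 2 (\<lambda>xs. rec_nat (tl xs ! 0) (\<lambda>i y. (i # y # tl xs) ! 1 - 1) (hd xs))"
    using total_prim_rec[OF total_proj[of 0 1], of "\<lambda>ys. ys ! 1 - 1"]
    by (simp add: numeral_2_eq_2 numeral_3_eq_3)
  moreover have "rec_nat y (\<lambda>i y. y - Suc 0) x = y - x" for x y by (induction x) auto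
  \<comment> \<open>The recursion runs over the first argument, which is the subtrahend, so the
    arguments have to be swapped afterwards.\<close>
  ultimately have "total_recf 2 (\<lambda>ys. ys ! 1 - ys ! 0)" by (elim total_cong) (auto simp: length_2_conv)
  from total_comp2[of "\<lambda>x y. y - x", OF this total_proj[of 1] total_proj[of 0]] show ?thesis by simp
qed

lemma computable_add [comp_intros]: "computable f \<Longrightarrow> computable g \<Longrightarrow> computable (\<lambda>x. f x + g x)"
  by (rule computable_compose2[OF total_add])

lemma computable_diff [comp_intros]: "computable f \<Longrightarrow> computable g \<Longrightarrow> computable (\<lambda>x. f x - g x)"
  by (rule computable_compose2[OF total_diff])

lemma computable_triangle: "computable triangle"
proof -
  have "total_recf 2 (\<lambda>ys. ys ! 0 + ys ! 1 + 1)"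
    using total_comp1[OF computable_Suc[OF computable_id] total_add] by simp
  then have "total_recf 1 (\<lambda>xs. rec_nat 0 (\<lambda>i y. (i # y # tl xs) ! 0 + (i # y # tl xs) ! 1 + 1) (hd xs))"
    using total_prim_rec[OF total_const[of 0 0], of "\<lambda>ys. ys ! 0 + ys ! 1 + 1"]
    by (simp add: numeral_2_eq_2)
  moreover have "rec_nat 0 (\<lambda>i y. Suc (i + y)) x = triangle x" for x :: nat by (induction x) auto
  ultimately show ?thesis unfolding computable_iff_total
    by (elim total_cong) (auto simp: length_Suc_conv)
qed

section \<open>Cantor pairing, its inverse and primitive recursion on unary functions\<close>

abbreviation pair :: "nat \<Rightarrow> nat \<Rightarrow> nat" where "pair a b \<equiv> prod_encode (a, b)"
abbreviation pfst :: "nat \<Rightarrow> nat" where "pfst c \<equiv> fst (prod_decode c)"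
abbreviation psnd :: "nat \<Rightarrow> nat" where "psnd c \<equiv> snd (prod_decode c)"

lemma total_pair: "total_recf n a \<Longrightarrow> total_recf n b \<Longrightarrow> total_recf n (\<lambda>xs. pair (a xs) (b xs))"
  unfolding prod_encode_def
  by (auto intro!: total_comp1[OF computable_triangle] total_comp2[OF total_add])

lemma computable_pair [comp_intros]:
  "computable f \<Longrightarrow> computable g \<Longrightarrow> computable (\<lambda>x. pair (f x) (g x))"
  unfolding prod_encode_def
  by (auto intro!: computable_compose[OF computable_triangle] comp_intros)

text \<open>A case distinction is a primitive recursion whose step ignores both the counter and the
  accumulator.\<close>

lemma total_if_0:
  assumes "total_recf n f" "total_recf n a" "total_recf n b"
  shows "total_recf n (\<lambda>xs. if f xs = 0 then a xs else b xs)"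
proof -
  have "total_recf 4 (\<lambda>ys. ys ! 3)" by (rule total_proj) simp
  then have "total_recf 3 (\<lambda>xs. rec_nat (tl xs ! 0) (\<lambda>i y. (i # y # tl xs) ! 3) (hd xs))"
    using total_prim_rec[OF total_proj[of 0 2], of "\<lambda>ys. ys ! 3"] by (simp add: eval_nat_numeral)
  moreover have "rec_nat u (\<lambda>i y. v) k = (if k = 0 then u else v)" for u v k :: nat by (cases k) auto
  ultimately have "total_recf 3 (\<lambda>ys. if ys ! 0 = 0 then ys ! 1 else ys ! 2)"
    by (elim total_cong) (auto simp: eval_nat_numeral length_Suc_conv)
  then have "total_recf (length [f, a, b]) (\<lambda>ys. if ys ! 0 = 0 then ys ! 1 else ys ! 2)"
    by (simp add: eval_nat_numeral)
  from total_comp[OF this, of n] show ?thesis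
    using assms by (auto simp: eval_nat_numeral cong: if_cong)
qed

text \<open>The number of the diagonal on which the Cantor pairing places its argument.\<close>

fun diagonal :: "nat \<Rightarrow> nat" where
  "diagonal 0 = 0"
| "diagonal (Suc n) = (if triangle (Suc (diagonal n)) - Suc n = 0 then Suc (diagonal n) else diagonal n)"

lemma diagonal: "triangle (diagonal n) \<le> n \<and> n < triangle (Suc (diagonal n))"
  by (induction n) auto

text \<open>By definition \<open>prod_encode (a, b)\<close> is \<open>triangle (a + b) + a\<close>:
  the first component is the offset of the code on its diagonal, and both components add up to the
  number of the diagonal.\<close>

lemma prod_decode_diagonal:
  "pfst n = n - triangle (diagonal n)"
  "psnd n = diagonal n - (n - triangle (diagonal n))"
proof -
  let ?a = "n - triangle (diagonal n)" and ?b = "diagonal n - (n - triangle (diagonal n))"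
  have "?a + ?b = diagonal n" using diagonal[of n] by simp
  then have "prod_encode (?a, ?b) = n" using diagonal[of n] by (simp add: prod_encode_def)
  then have "prod_decode n = (?a, ?b)" by (metis prod_encode_inverse)
  then show "pfst n = ?a" "psnd n = ?b" by simp_all
qed

lemma computable_diagonal: "computable diagonal"
proof -
  let ?F = "\<lambda>c m. if triangle (Suc c) - Suc m = 0 then Suc c else c"
  have S: "total_recf 2 f \<Longrightarrow> total_recf 2 (\<lambda>xs. Suc (f xs))" for f
    by (rule total_comp1) (auto intro: comp_intros computable_id)
  have "total_recf 2 (\<lambda>ys. ?F (ys ! 1) (ys ! 0))"
    by (intro total_if_0 total_comp2[OF total_diff] S total_proj
        total_comp1[OF computable_triangle]) simp_all
  then have "total_recf 1 (\<lambda>xs. rec_nat 0 (\<lambda>i y. ?F ((i # y # tl xs) ! 1) ((i # y # tl xs) ! 0)) (hd xs))"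
    using total_prim_rec[OF total_const[of 0 0], of "\<lambda>ys. ?F (ys ! 1) (ys ! 0)"]
    by (simp add: numeral_2_eq_2)
  moreover have "rec_nat 0 (\<lambda>i y. ?F y i) x = diagonal x" for x :: nat by (induction x) auto
  ultimately show ?thesis unfolding computable_iff_total
    by (elim total_cong) (auto simp: length_Suc_conv cong: if_cong)
qed

lemma computable_pfst [comp_intros]: "computable f \<Longrightarrow> computable (\<lambda>x. pfst (f x))"
  unfolding prod_decode_diagonal
  by (auto intro!: comp_intros computable_compose[OF computable_triangle] computable_compose[OF computable_diagonal])

lemma computable_psnd [comp_intros]: "computable f \<Longrightarrow> computable (\<lambda>x. psnd (f x))"
  unfolding prod_decode_diagonal
  by (auto intro!: comp_intros computable_compose[OF computable_triangle] computable_compose[OF computable_diagonal])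

text \<open>Parameter, counter and accumulator of the step function are packed into one number,
  since \<open>computable\<close> is unary. Keeping the parameter \<open>x\<close> lets the
  recursion be used inside other computable expressions.\<close>

lemma computable_rec_nat:
  assumes f: "computable f" and k: "computable k"
    and g: "computable (\<lambda>p. g (pfst p) (pfst (psnd p)) (psnd (psnd p)))"
  shows "computable (\<lambda>x. rec_nat (f x) (\<lambda>i y. g x i y) (k x))"
proof -
  have "total_recf 3 (\<lambda>ys. g (ys ! 2) (ys ! 0) (ys ! 1))"
    using total_comp1[OF g total_pair[OF total_proj[of 2 3] total_pair[OF total_proj[of 0 3] total_proj[of 1 3]]]] by simp
  moreover have "total_recf 1 (\<lambda>ys. f (ys ! 0))" using f by (simp add: computable_iff_total)
  ultimately have "total_recf 2 (\<lambda>xs. rec_nat (f (tl xs ! 0))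
      (\<lambda>i y. g ((i # y # tl xs) ! 2) ((i # y # tl xs) ! 0) ((i # y # tl xs) ! 1)) (hd xs))"
    using total_prim_rec[of 1 "\<lambda>ys. f (ys ! 0)" "\<lambda>ys. g (ys ! 2) (ys ! 0) (ys ! 1)"]
    by (simp add: eval_nat_numeral)
  then have "total_recf 2 (\<lambda>xs. rec_nat (f (xs ! 1)) (\<lambda>i y. g (xs ! 1) i y) (xs ! 0))"
    by (elim total_cong) (auto simp: length_2_conv)
  from computable_compose2[of "\<lambda>n x. rec_nat (f x) (\<lambda>i y. g x i y) n", OF this k computable_id]
  show ?thesis .
qed

section \<open>Decidable predicates\<close>

definition decidable :: "(nat \<Rightarrow> bool) \<Rightarrow> bool" where
  "decidable P \<longleftrightarrow> computable (\<lambda>x. of_bool (P x))"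

lemma decidable_not [comp_intros]: "decidable P \<Longrightarrow> decidable (\<lambda>x. \<not> P x)"
proof -
  have "(of_bool (\<not> p) :: nat) = 1 - of_bool p" for p by simp
  then show "decidable P \<Longrightarrow> decidable (\<lambda>x. \<not> P x)"
    unfolding decidable_def by (simp only:) (intro comp_intros)
qed

lemma computable_if [comp_intros]:
  assumes "decidable P" "computable a" "computable b"
  shows "computable (\<lambda>x. if P x then a x else b x)"
proof -
  have "total_recf 1 (\<lambda>xs. if of_bool (\<not> P (xs ! 0)) = (0::nat) then a (xs ! 0) else b (xs ! 0))"
    using decidable_not[OF assms(1)] assms(2,3) unfolding decidable_def computable_iff_total
    by (rule total_if_0)
  then show ?thesis unfolding computable_iff_total by (simp add: if_distrib)
qed

lemma decidable_le [comp_intros]: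
  assumes "computable f" "computable g"
  shows "decidable (\<lambda>x. f x \<le> g x)"
proof -
  have "(of_bool (m \<le> n) :: nat) = 1 - (m - n)" for m n :: nat by auto
  then show ?thesis using assms unfolding decidable_def by (simp only:) (intro comp_intros)
qed

lemma decidable_conj [comp_intros]:
  assumes "decidable P" "decidable Q"
  shows "decidable (\<lambda>x. P x \<and> Q x)"
proof -
  have "(of_bool (p \<and> q) :: nat) = (if p then of_bool q else 0)" for p q by simp
  then show ?thesis
    using computable_if[OF assms(1) assms(2)[unfolded decidable_def] computable_const[of 0]]
    unfolding decidable_def by simp
qed

lemma decidable_disj [comp_intros]: "decidable P \<Longrightarrow> decidable Q \<Longrightarrow> decidable (\<lambda>x. P x \<or> Q x)"
  using decidable_not[OF decidable_conj[OF decidable_not decidable_not], of P Q] by simp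

lemma decidable_eq [comp_intros]:
  assumes "computable f" "computable g"
  shows "decidable (\<lambda>x. f x = g x)"
  using decidable_conj[OF decidable_le[OF assms] decidable_le[OF assms(2,1)]]
  by (simp add: eq_iff)

section \<open>Folds over coded lists\<close>

lemma length_le_list_encode: "length xs \<le> list_encode xs"
proof (induction xs)
  case (Cons x xs)
  then show ?case using le_prod_encode_2[of "list_encode xs" x] by simp
qed simp

lemma pfst_le: "pfst n \<le> n" and psnd_le: "psnd n \<le> n"
  using le_prod_encode_1[of "pfst n" "psnd n"] le_prod_encode_2[of "psnd n" "pfst n"] by simp_all

lemma list_decode_nonzero: "c \<noteq> 0 \<Longrightarrow> list_decode c = pfst (c - 1) # list_decode (psnd (c - 1))"
  by (cases c) (auto simp: case_prod_beta)

lemma prod_decode_0 [simp]: "prod_decode 0 = (0, 0)"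
  using prod_encode_inverse[of "(0, 0)"] by (simp add: prod_encode_def)

text \<open>The state pairs the code of the remaining list with the accumulator. The code itself
  serves as the number of rounds: it is at least the length of the list, and rounds on an empty list
  change nothing.\<close>

lemma computable_fold:
  assumes l: "computable l" and b: "computable b"
    and f: "computable (\<lambda>p. f (pfst p) (pfst (psnd p)) (psnd (psnd p)))"
  shows "computable (\<lambda>x. fold (f x) (list_decode (l x)) (b x))"
proof -
  define step where "step = (\<lambda>x y. if pfst y = 0 then y else
    pair (psnd (pfst y - 1)) (f x (pfst (pfst y - 1)) (psnd y)))"
  have step: "rec_nat (pair (list_encode xs) c) (\<lambda>_. step x) n
      = pair (list_encode (drop n xs)) (fold (f x) (take n xs) c)" for x xs c n
  proof (induction n)
    case (Suc n)
    show ?case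
    proof (cases "n < length xs")
      case True
      then have "drop n xs = xs ! n # drop (Suc n) xs" by (simp add: Cons_nth_drop_Suc)
      then show ?thesis using Suc True by (simp add: step_def take_Suc_conv_app_nth)
    next
      case False
      then show ?thesis using Suc by (simp add: step_def)
    qed
  qed simp
  have eq: "fold (f x) (list_decode (l x)) (b x) = psnd (rec_nat (pair (l x) (b x)) (\<lambda>_. step x) (l x))" for x
    using step[of "list_decode (l x)" "b x" x "l x"] length_le_list_encode[of "list_decode (l x)"] by simp
  have "computable (\<lambda>p. pair (pfst p) (pair (pfst (pfst (psnd (psnd p)) - 1)) (psnd (psnd (psnd p)))))"
    by (intro comp_intros computable_id)
  from computable_compose[OF f this]
  have "computable (\<lambda>p. f (pfst p) (pfst (pfst (psnd (psnd p)) - 1)) (psnd (psnd (psnd p))))"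
    by simp
  then show ?thesis
    unfolding eq step_def
    by (intro comp_intros computable_rec_nat l b computable_id)
qed

subsection \<open>Enumerating inductively generated sets\<close>

text \<open>\<open>k\<close> selects the rule. In the application below the three slots hold the at
  most two premises of a rule and pairs from which further formulas are read off; axioms are rules
  whose premises are mere suppliers of formulas.\<close>

inductive_set generated :: "(nat \<Rightarrow> nat \<Rightarrow> nat \<Rightarrow> nat \<Rightarrow> nat) \<Rightarrow> nat \<Rightarrow> nat set" for F b where
  base: "b \<in> generated F b"
| step: "x \<in> generated F b \<Longrightarrow> y \<in> generated F b \<Longrightarrow> z \<in> generated F b \<Longrightarrow> F k x y z \<in> generated F b"

text \<open>Stage \<open>Suc n\<close> reads \<open>n\<close> as a rule together with three stages
  for its premises. These are earlier stages because no component of a pair exceeds its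
  code.\<close>

function gen_enum :: "(nat \<Rightarrow> nat \<Rightarrow> nat \<Rightarrow> nat \<Rightarrow> nat) \<Rightarrow> nat \<Rightarrow> nat \<Rightarrow> nat" where
  "gen_enum F b 0 = b"
| "gen_enum F b (Suc n) = F (pfst n) (gen_enum F b (pfst (psnd n)))
     (gen_enum F b (pfst (psnd (psnd n)))) (gen_enum F b (psnd (psnd (psnd n))))"
  by pat_completeness auto
termination
proof (relation "measure (\<lambda>(F, b, n). n)")
  fix n
  have 1: "pfst (psnd n) \<le> n" using pfst_le psnd_le le_trans by blast
  have 2: "psnd (psnd n) \<le> n" using psnd_le le_trans by blast
  have 3: "pfst (psnd (psnd n)) \<le> n" "psnd (psnd (psnd n)) \<le> n"
    using 2 pfst_le psnd_le le_trans by blast+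
  fix F :: "nat \<Rightarrow> nat \<Rightarrow> nat \<Rightarrow> nat \<Rightarrow> nat" and b :: nat
  show "((F, b, pfst (psnd n)), F, b, Suc n) \<in> measure (\<lambda>(F, b, n). n)"
    "((F, b, pfst (psnd (psnd n))), F, b, Suc n) \<in> measure (\<lambda>(F, b, n). n)"
    "((F, b, psnd (psnd (psnd n))), F, b, Suc n) \<in> measure (\<lambda>(F, b, n). n)"
    using 1 3 by simp_all
qed simp

lemma range_gen_enum: "range (gen_enum F b) = generated F b"
proof
  have "gen_enum F b n \<in> generated F b" for n
    by (induction F b n rule: gen_enum.induct) (auto intro: generated.intros)
  then show "range (gen_enum F b) \<subseteq> generated F b" by blast
next
  have "\<exists>n. gen_enum F b n = x" if "x \<in> generated F b" for x
    using that
  proof induction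
    case base
    show ?case using gen_enum.simps(1) by blast
  next
    case (step x y z k)
    then obtain p q r where "gen_enum F b p = x" "gen_enum F b q = y" "gen_enum F b r = z" by blast
    then have "gen_enum F b (Suc (pair k (pair p (pair q r)))) = F k x y z" by simp
    then show ?case by blast
  qed
  then show "generated F b \<subseteq> range (gen_enum F b)" by blast
qed

text \<open>Course-of-values recursion: the values below \<open>n\<close> are collected in a list code, from which
  the value at \<open>i\<close> is read off after dropping \<open>n - 1 - i\<close> entries.\<close>

lemma computable_gen_enum:
  assumes F: "computable (\<lambda>p. F (pfst p) (pfst (psnd p)) (pfst (psnd (psnd p))) (psnd (psnd (psnd p))))"
  shows "computable (gen_enum F b)"
proof -
  define look where "look = (\<lambda>h n i. pfst (rec_nat h (\<lambda>_ y. psnd (y - 1)) (n - 1 - i) - 1))"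
  define val where "val = (\<lambda>n h. if n = 0 then b else F (pfst (n - 1)) (look h n (pfst (psnd (n - 1))))
    (look h n (pfst (psnd (psnd (n - 1))))) (look h n (psnd (psnd (psnd (n - 1))))))"
  define H where "H = (\<lambda>n. list_encode (map (gen_enum F b) (rev [0..<n])))"
  have drop: "rec_nat (list_encode xs) (\<lambda>_ y. psnd (y - 1)) k = list_encode (drop k xs)" for xs k
  proof (induction k)
    case (Suc k)
    show ?case
    proof (cases "k < length xs")
      case True
      then have "drop k xs = xs ! k # drop (Suc k) xs" by (simp add: Cons_nth_drop_Suc)
      then show ?thesis using Suc by simp
    qed (use Suc in simp)
  qed simp
  have look: "look (H n) n i = gen_enum F b i" if "i < n" for i n
  proof -
    let ?xs = "map (gen_enum F b) (rev [0..<n])"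
    have "drop (n - 1 - i) ?xs = ?xs ! (n - 1 - i) # drop (Suc (n - 1 - i)) ?xs"
      using that by (intro Cons_nth_drop_Suc[symmetric]) simp
    moreover have "?xs ! (n - 1 - i) = gen_enum F b i"
      using that by (simp add: rev_nth)
    ultimately show ?thesis unfolding look_def H_def drop by simp
  qed
  have val: "val n (H n) = gen_enum F b n" for n
  proof (cases n)
    case (Suc m)
    have "pfst (psnd m) < n" "pfst (psnd (psnd m)) < n" "psnd (psnd (psnd m)) < n"
      using Suc pfst_le psnd_le by (meson le_imp_less_Suc le_trans)+
    then show ?thesis using look by (simp add: val_def Suc)
  qed (simp add: val_def)
  have H: "H n = rec_nat 0 (\<lambda>n h. Suc (pair (val n h) h)) n" for n
  proof (induction n)
    case (Suc n)
    have "H (Suc n) = Suc (pair (gen_enum F b n) (H n))" by (simp add: H_def)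
    then show ?case using Suc val[of n] by simp
  qed (simp add: H_def)
  have look': "computable f \<Longrightarrow> computable g \<Longrightarrow> computable h \<Longrightarrow> computable (\<lambda>x. look (f x) (g x) (h x))" for f g h
    unfolding look_def by (intro comp_intros computable_rec_nat computable_id)
  have val': "computable f \<Longrightarrow> computable g \<Longrightarrow> computable (\<lambda>x. val (f x) (g x))" for f g
  proof -
    assume fg: "computable f" "computable g"
    have "computable (\<lambda>x. pair (pfst (f x - 1)) (pair (look (g x) (f x) (pfst (psnd (f x - 1))))
      (pair (look (g x) (f x) (pfst (psnd (psnd (f x - 1))))) (look (g x) (f x) (psnd (psnd (psnd (f x - 1))))))))"
      by (intro comp_intros look' fg)
    \<comment> \<open>\<open>F\<close> is computable on packed arguments only, so the looked-up
      values are packed first.\<close>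
    from computable_compose[OF F this]
    have "computable (\<lambda>x. F (pfst (f x - 1)) (look (g x) (f x) (pfst (psnd (f x - 1))))
      (look (g x) (f x) (pfst (psnd (psnd (f x - 1))))) (look (g x) (f x) (psnd (psnd (psnd (f x - 1))))))"
      by simp
    then show ?thesis unfolding val_def by (intro comp_intros fg)
  qed
  have "computable (\<lambda>n. val n (rec_nat 0 (\<lambda>n h. Suc (pair (val n h) h)) n))"
    by (intro val' comp_intros computable_rec_nat computable_id)
  then show ?thesis by (simp only: H[symmetric] val)
qed

subsection \<open>Bounded evaluation\<close>

text \<open>Evaluation with all searches cut off at \<open>t\<close>; the value \<open>0\<close> stands for failure and
  \<open>Suc y\<close> for the result \<open>y\<close>. The accumulator of the search is \<open>0\<close> while the search is running,
  \<open>1\<close> once it has failed and \<open>i + 2\<close> once it has found \<open>i\<close>.\<close>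

primrec eval_bound :: "recf \<Rightarrow> nat \<Rightarrow> nat list \<Rightarrow> nat" where
  "eval_bound Zero = (\<lambda>t xs. 1)"
| "eval_bound Succ = (\<lambda>t xs. if length xs = 1 then Suc (Suc (hd xs)) else 0)"
| "eval_bound (Proj i) = (\<lambda>t xs. if i < length xs then Suc (xs ! i) else 0)"
| "eval_bound (Comp f gs) = (\<lambda>t xs. let ys = map (\<lambda>h. h t xs) (map eval_bound gs) in
     if 0 \<in> set ys then 0 else eval_bound f t (map (\<lambda>y. y - 1) ys))"
| "eval_bound (PrimRec f g) = (\<lambda>t xs. case xs of [] \<Rightarrow> 0 | n # ys \<Rightarrow>
     rec_nat (eval_bound f t ys) (\<lambda>i y. if y = 0 then 0 else eval_bound g t (i # (y - 1) # ys)) n)"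
| "eval_bound (Mu f) = (\<lambda>t xs.
     rec_nat 0 (\<lambda>i a. if a = 0 then (if eval_bound f t (i # xs) = 0 then 1
       else if eval_bound f t (i # xs) = 1 then i + 2 else 0) else a) t - 1)"

lemma eval_bound_sound: "eval_bound f t xs = Suc y \<Longrightarrow> rec_eval f xs y"
proof (induction f arbitrary: xs y)
  case Zero
  then show ?case using rec_Zero by simp
next
  case Succ
  then show ?case using rec_Succ by (auto simp: length_Suc_conv split: if_splits)
next
  case (Proj i)
  then show ?case using rec_Proj by (auto split: if_splits)
next
  case (Comp f gs)
  let ?ys = "map (\<lambda>g. eval_bound g t xs) gs"
  have nz: "0 \<notin> set ?ys" and f: "eval_bound f t (map (\<lambda>y. y - 1) ?ys) = Suc y"
    using Comp.prems by (auto simp: Let_def comp_def split: if_splits)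
  have "list_all2 (\<lambda>g y. rec_eval g xs y) gs (map (\<lambda>y. y - 1) ?ys)"
    using Comp.IH(2) nz by (auto simp: list_all2_conv_all_nth image_iff Suc_pred' )
  then show ?case using Comp.IH(1)[OF f] by (rule rec_Comp)
next
  case (PrimRec f g)
  obtain n ys where xs: "xs = n # ys" using PrimRec.prems by (cases xs) auto
  define R where "R = rec_nat (eval_bound f t ys)
    (\<lambda>i y. if y = 0 then 0 else eval_bound g t (i # (y - 1) # ys))"
  have R: "R 0 = eval_bound f t ys"
    "\<And>n. R (Suc n) = (if R n = 0 then 0 else eval_bound g t (n # (R n - 1) # ys))"
    by (auto simp: R_def)
  have "R n = Suc y \<Longrightarrow> rec_eval (PrimRec f g) (n # ys) y" for y n
  proof (induction n arbitrary: y)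
    case 0
    then show ?case using PrimRec.IH(1) R(1) rec_PrimRec_0 by metis
  next
    case (Suc n)
    then obtain z where z: "R n = Suc z" using R(2) by (cases "R n") auto
    then have "eval_bound g t (n # z # ys) = Suc y" using Suc.prems R(2) by simp
    then show ?case using PrimRec.IH(2) Suc.IH[OF z] rec_PrimRec_Suc by blast
  qed
  then show ?case using PrimRec.prems xs by (simp add: R_def)
next
  case (Mu f)
  define A where "A = rec_nat 0 (\<lambda>i a. if a = 0 then (if eval_bound f t (i # xs) = 0 then 1
       else if eval_bound f t (i # xs) = 1 then i + 2 else 0) else a)"
  have A: "A 0 = 0" "\<And>i. A (Suc i) = (if A i = 0 then (if eval_bound f t (i # xs) = 0 then 1
       else if eval_bound f t (i # xs) = 1 then i + 2 else 0) else A i)"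
    by (auto simp: A_def)
  \<comment> \<open>While the accumulator is \<open>0\<close>, all values seen were defined and
    positive; \<open>m + 2\<close> records a zero at \<open>m\<close> preceded by such
    values.\<close>
  have inv: "(A n = 0 \<longrightarrow> (\<forall>i<n. \<exists>y. eval_bound f t (i # xs) = Suc (Suc y))) \<and>
    (\<forall>m. A n = m + 2 \<longrightarrow> eval_bound f t (m # xs) = 1 \<and> (\<forall>i<m. \<exists>y. eval_bound f t (i # xs) = Suc (Suc y)))" for n
  proof (induction n)
    case (Suc n)
    consider "A n \<noteq> 0" | "A n = 0" "eval_bound f t (n # xs) = 0" | "A n = 0" "eval_bound f t (n # xs) = 1"
      | y where "A n = 0" "eval_bound f t (n # xs) = Suc (Suc y)"
      by (metis One_nat_def not0_implies_Suc)
    then show ?case using Suc by cases (simp_all add: A(2) less_Suc_eq)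
  qed (auto simp: A)
  \<comment> \<open>The final subtraction of 1 maps both a running search (\<open>0\<close>) and a
    failed one (\<open>1\<close>) to failure, and a search that found \<open>y\<close> to
    \<open>Suc y\<close>.\<close>
  have "A t = y + 2" using Mu.prems by (simp add: A_def)
  then have "eval_bound f t (y # xs) = 1" "\<forall>i<y. \<exists>z. eval_bound f t (i # xs) = Suc (Suc z)"
    using inv by blast+
  then have "rec_eval f (y # xs) 0" "\<forall>m<y. \<exists>z. rec_eval f (m # xs) (Suc z)"
    using Mu.IH by (simp, blast)
  then show ?case by (rule rec_Mu)
qed

text \<open>Phrased with \<open>eventually\<close> because all subevaluations have to succeed under
  one common bound: finitely many statements that hold eventually also hold eventually
  together.\<close>

lemma eval_bound_complete:
  "rec_eval f xs y \<Longrightarrow> eventually (\<lambda>t. eval_bound f t xs = Suc y) sequentially"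
proof (induction rule: rec_eval.induct)
  case (rec_Comp xs gs ys f z)
  have "eventually (\<lambda>t. \<forall>i\<in>{..<length gs}. eval_bound (gs ! i) t xs = Suc (ys ! i)) sequentially"
    using rec_Comp.IH(1) by (intro eventually_ball_finite) (auto simp: list_all2_conv_all_nth)
  then show ?case using rec_Comp.IH(2)
  proof eventually_elim
    case (elim t)
    have "map (\<lambda>g. eval_bound g t xs) gs = map Suc ys"
      using elim(1) rec_Comp.IH(1) by (intro nth_equalityI) (auto simp: list_all2_lengthD)
    moreover from this have "(\<lambda>g. eval_bound g t xs) ` set gs = Suc ` set ys"
      by (metis list.set_map)
    moreover have "map (\<lambda>y. y - 1) (map Suc ys) = ys" by (simp add: comp_def)
    ultimately show ?case using elim(2) by (auto simp: comp_def Let_def)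
  qed
next
  case (rec_PrimRec_Suc f g n xs y z)
  from rec_PrimRec_Suc.IH show ?case by eventually_elim simp
next
  case (rec_Mu f n xs)
  have "eventually (\<lambda>t. \<forall>m\<in>{..<n}. \<exists>y. eval_bound f t (m # xs) = Suc (Suc y)) sequentially"
  proof (intro eventually_ball_finite ballI)
    fix m assume "m \<in> {..<n}"
    then obtain y where "eventually (\<lambda>t. eval_bound f t (m # xs) = Suc (Suc y)) sequentially"
      using rec_Mu.IH(2) by auto
    then show "eventually (\<lambda>t. \<exists>y. eval_bound f t (m # xs) = Suc (Suc y)) sequentially"
      by (rule eventually_mono) blast
  qed simp
  then show ?case using rec_Mu.IH(1) eventually_gt_at_top[of n]
  proof eventually_elim
    case (elim t)
    define A where "A = rec_nat 0 (\<lambda>i a. if a = 0 then (if eval_bound f t (i # xs) = 0 then 1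
       else if eval_bound f t (i # xs) = 1 then i + 2 else 0) else a)"
    have A: "A 0 = 0" "\<And>i. A (Suc i) = (if A i = 0 then (if eval_bound f t (i # xs) = 0 then 1
       else if eval_bound f t (i # xs) = 1 then i + 2 else 0) else A i)"
      by (auto simp: A_def)
    have "k \<le> n \<Longrightarrow> A k = 0" for k
    proof (induction k)
      case (Suc k)
      then have "k \<in> {..<n}" by simp
      with elim(1) obtain y where "eval_bound f t (k # xs) = Suc (Suc y)" by blast
      then show ?case using Suc by (simp add: A)
    qed (simp add: A)
    \<comment> \<open>Round \<open>n\<close> finds the zero, and \<open>n < t\<close> makes it take
      place; from then on the nonzero accumulator is kept.\<close>
    then have "A (Suc n) = n + 2" using elim(2) by (simp add: A)
    then have "A (Suc n + d) = n + 2" for d by (induction d) (simp_all add: A)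
    from this[of "t - Suc n"] have "A t = n + 2" using elim(3) by simp
    then show ?case by (simp add: A_def)
  qed
qed simp_all

lemma computable_nth:
  "computable l \<Longrightarrow> computable (\<lambda>x. if i < length (list_decode (l x)) then Suc (list_decode (l x) ! i) else 0)"
proof (induction i arbitrary: l)
  case 0
  have "(if 0 < length (list_decode c) then Suc (list_decode c ! 0) else 0) = (if c = 0 then 0 else Suc (pfst (c - 1)))" for c
    using list_decode_nonzero[of c] by simp
  then show ?case using 0 by (simp only:) (intro comp_intros)
next
  case (Suc i)
  define N where "N = (\<lambda>c. if i < length (list_decode c) then Suc (list_decode c ! i) else 0)"
  have "computable (\<lambda>x. N (psnd (l x - 1)))"
    unfolding N_def by (intro Suc.IH comp_intros Suc.prems)
  then have "computable (\<lambda>x. if l x = 0 then 0 else N (psnd (l x - 1)))"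
    by (intro comp_intros Suc.prems)
  moreover have "(if Suc i < length (list_decode c) then Suc (list_decode c ! Suc i) else 0)
    = (if c = 0 then 0 else N (psnd (c - 1)))" for c
    using list_decode_nonzero[of c] by (simp add: N_def)
  ultimately show ?case by (simp only:)
qed

text \<open>\<open>f\<close> is a fixed term, taken apart by induction outside of the computation.
  Bound and argument list are arbitrary computable functions, so that the hypotheses cover the
  modified lists in recursion and search.\<close>

lemma computable_eval_bound:
  "computable t \<Longrightarrow> computable l \<Longrightarrow> computable (\<lambda>x. eval_bound f (t x) (list_decode (l x)))"
proof (induction f arbitrary: t l)
  case Zero
  then show ?case by (simp add: computable_const)
next
  case Succ
  have "(if length (list_decode c) = 1 then Suc (Suc (hd (list_decode c))) else 0)
    = (if c = 0 then 0 else if psnd (c - 1) = 0 then Suc (Suc (pfst (c - 1))) else 0)" for c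
    using list_decode_nonzero[of c] list_decode_nonzero[of "psnd (c - 1)"] by auto
  then show ?case using Succ by (simp only: eval_bound.simps) (intro comp_intros)
next
  case (Proj i)
  then show ?case using computable_nth by simp
next
  case (Comp f gs)
  let ?ys = "\<lambda>gs x. map (\<lambda>g. eval_bound g (t x) (list_decode (l x))) gs"
  \<comment> \<open>All arguments of the composition in one number: \<open>0\<close> if one of them
    fails, otherwise \<open>Suc\<close> of the code of their list.\<close>
  define R where "R = (\<lambda>gs x. if 0 \<in> set (?ys gs x) then 0 else Suc (list_encode (map (\<lambda>y. y - 1) (?ys gs x))))"
  have R: "computable (R gs)"
    using Comp.IH(2)
  proof (induction gs)
    case Nil
    then show ?case by (simp add: R_def computable_const)
  next
    case (Cons g gs)
    have "computable (R gs)" using Cons by simp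
    moreover have "computable (\<lambda>x. eval_bound g (t x) (list_decode (l x)))" using Cons.prems Comp.prems by simp
    ultimately have "computable (\<lambda>x. if eval_bound g (t x) (list_decode (l x)) = 0 \<or> R gs x = 0 then 0
      else Suc (Suc (pair (eval_bound g (t x) (list_decode (l x)) - 1) (R gs x - 1))))"
      by (intro comp_intros)
    then show ?case by (rule back_subst[of computable]) (auto simp: R_def fun_eq_iff)
  qed
  moreover have "computable (\<lambda>x. eval_bound f (t x) (list_decode (R gs x - 1)))"
    using R Comp.prems by (intro Comp.IH(1) comp_intros)
  ultimately have "computable (\<lambda>x. if R gs x = 0 then 0 else eval_bound f (t x) (list_decode (R gs x - 1)))"
    by (intro comp_intros)
  then show ?case by (rule back_subst[of computable]) (auto simp: R_def fun_eq_iff Let_def comp_def)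
next
  case (PrimRec f g)
  have "(case list_decode c of [] \<Rightarrow> 0 | n # ys \<Rightarrow>
     rec_nat (eval_bound f t ys) (\<lambda>i y. if y = 0 then 0 else eval_bound g t (i # (y - 1) # ys)) n)
    = (if c = 0 then 0 else rec_nat (eval_bound f t (list_decode (psnd (c - 1))))
        (\<lambda>i y. if y = 0 then 0 else eval_bound g t (list_decode (Suc (pair i (Suc (pair (y - 1) (psnd (c - 1)))))))) (pfst (c - 1)))" for c t
    using list_decode_nonzero[of c] by (simp cong: if_cong)
  moreover have "computable (\<lambda>x. (if l x = 0 then 0 else rec_nat (eval_bound f (t x) (list_decode (psnd (l x - 1))))
        (\<lambda>i y. if y = 0 then 0 else eval_bound g (t x) (list_decode (Suc (pair i (Suc (pair (y - 1) (psnd (l x - 1)))))))) (pfst (l x - 1))))"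
    by (intro comp_intros computable_rec_nat PrimRec.IH computable_id PrimRec.prems
        computable_compose[OF PrimRec.prems(1)] computable_compose[OF PrimRec.prems(2)])
  ultimately show ?case by simp
next
  case (Mu f)
  have "computable (\<lambda>x. rec_nat 0 (\<lambda>i a. if a = 0 then (if eval_bound f (t x) (list_decode (Suc (pair i (l x)))) = 0 then 1
       else if eval_bound f (t x) (list_decode (Suc (pair i (l x)))) = 1 then i + 2 else 0) else a) (t x) - 1)"
    by (intro comp_intros computable_rec_nat Mu.IH computable_id Mu.prems
        computable_compose[OF Mu.prems(1)] computable_compose[OF Mu.prems(2)])
  then show ?case by (simp cong: if_cong)
qed

section \<open>Enumerable sets as projections of decidable relations\<close>

lemma minimization:
  assumes P: "decidable P"
  obtains f where "\<And>x y. rec_eval f [x] y \<longleftrightarrow> P (pair y x) \<and> (\<forall>m<y. \<not> P (pair m x))"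
proof -
  have "total_recf 2 (\<lambda>ys. pair (ys ! 0) (ys ! 1))"
    by (intro total_pair total_proj) simp_all
  moreover have "computable (\<lambda>p. of_bool (\<not> P p))"
    using decidable_not[OF P] by (simp add: decidable_def)
  ultimately have "total_recf 2 (\<lambda>ys. of_bool (\<not> P (pair (ys ! 0) (ys ! 1))))"
    using total_comp1 by fast
  then obtain r where r: "\<And>xs. length xs = 2 \<Longrightarrow> rec_eval r xs (of_bool (\<not> P (pair (xs ! 0) (xs ! 1))))"
    unfolding total_recf_def by blast
  have r': "rec_eval r [t, x] z \<longleftrightarrow> z = of_bool (\<not> P (pair t x))" for t x z
    using r[of "[t, x]"] rec_eval_deterministic by auto
  have "rec_eval (Mu r) [x] y \<longleftrightarrow> P (pair y x) \<and> (\<forall>m<y. \<not> P (pair m x))" for x y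
  proof
    assume "rec_eval (Mu r) [x] y"
    then show "P (pair y x) \<and> (\<forall>m<y. \<not> P (pair m x))" by (rule rec_MuE) (auto simp: r')
  next
    assume "P (pair y x) \<and> (\<forall>m<y. \<not> P (pair m x))"
    then show "rec_eval (Mu r) [x] y" by (intro rec_Mu) (auto simp: r')
  qed
  then show ?thesis using that by blast
qed

text \<open>In one direction the witness \<open>t\<close> is a bound on all searches, which turns
  evaluation into a total function; in the other, the witness is found by minimization.\<close>

lemma recursively_enumerable_iff:
  "recursively_enumerable A \<longleftrightarrow> (\<exists>P. decidable P \<and> (\<forall>x. x \<in> A \<longleftrightarrow> (\<exists>t. P (pair t x))))"
proof
  assume "recursively_enumerable A"
  then obtain f where f: "\<And>x. x \<in> A \<longleftrightarrow> (\<exists>y. rec_eval f [x] y)" unfolding recursively_enumerable_def by blast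
  \<comment> \<open>\<open>Suc (pair x 0)\<close> is the code of the list
    \<open>[x]\<close>.\<close>
  let ?P = "\<lambda>p. eval_bound f (pfst p) (list_decode (Suc (pair (psnd p) 0))) \<noteq> 0"
  have "decidable ?P"
    by (intro comp_intros computable_eval_bound computable_id)
  moreover have "x \<in> A \<longleftrightarrow> (\<exists>t. ?P (pair t x))" for x
  proof -
    have P: "?P (pair t x) \<longleftrightarrow> eval_bound f t [x] \<noteq> 0" for t by simp
    show ?thesis
    proof
      assume "x \<in> A"
      then obtain y where "rec_eval f [x] y" using f by blast
      from eval_bound_complete[OF this] obtain t where "eval_bound f t [x] = Suc y"
        by (auto simp: eventually_sequentially)
      then have "?P (pair t x)" unfolding P by simp
      then show "\<exists>t. ?P (pair t x)" by blast
    next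
      assume "\<exists>t. ?P (pair t x)"
      then obtain t y where "eval_bound f t [x] = Suc y" unfolding P using not0_implies_Suc by blast
      then show "x \<in> A" using eval_bound_sound f by blast
    qed
  qed
  ultimately show "\<exists>P. decidable P \<and> (\<forall>x. x \<in> A \<longleftrightarrow> (\<exists>t. P (pair t x)))" by blast
next
  assume "\<exists>P. decidable P \<and> (\<forall>x. x \<in> A \<longleftrightarrow> (\<exists>t. P (pair t x)))"
  then obtain P where P: "decidable P" "\<And>x. x \<in> A \<longleftrightarrow> (\<exists>t. P (pair t x))" by blast
  from minimization[OF P(1)] obtain f where "\<And>x y. rec_eval f [x] y \<longleftrightarrow> P (pair y x) \<and> (\<forall>m<y. \<not> P (pair m x))" by blast
  then have "\<forall>x. x \<in> A \<longleftrightarrow> (\<exists>y. rec_eval f [x] y)"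
    by (auto simp: P(2) exists_least_iff[of "\<lambda>t. P (pair t _)"])
  then show "recursively_enumerable A" unfolding recursively_enumerable_def by blast
qed

section \<open>The order of derivability\<close>

text \<open>The laws of commutative residuated lattices with star, free of contexts, so that a pair
  of codes represents an instance. Reflexivity is postulated for \<open>One\<close> and variables
  only: the enumeration takes formulas from pairs already generated and has to build up all others
  from these.\<close>

inductive leq :: "form \<Rightarrow> form \<Rightarrow> bool" (infix "\<preceq>" 50) where
  leq_One: "One \<preceq> One"
| leq_Var: "Var n \<preceq> Var n"
| leq_trans: "A \<preceq> B \<Longrightarrow> B \<preceq> C \<Longrightarrow> A \<preceq> C"
| leq_mono: "A \<preceq> B \<Longrightarrow> C \<preceq> D \<Longrightarrow> Tens A C \<preceq> Tens B D"
| leq_comm: "Tens A B \<preceq> Tens B A"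
| leq_assoc: "Tens (Tens A B) C \<preceq> Tens A (Tens B C)"
| leq_unit1: "A \<preceq> Tens One A"
| leq_unit2: "Tens One A \<preceq> A"
| leq_app: "Tens A (Imp A B) \<preceq> B"
| leq_coapp: "B \<preceq> Imp A (Tens A B)"
| leq_Imp: "A \<preceq> B \<Longrightarrow> Imp C A \<preceq> Imp C B"
| leq_Bot: "Bot \<preceq> A"
| leq_Or1: "A \<preceq> Or A B"
| leq_Or2: "B \<preceq> Or A B"
| leq_OrL: "A \<preceq> C \<Longrightarrow> B \<preceq> C \<Longrightarrow> Or A B \<preceq> C"
| leq_And1: "And A B \<preceq> A"
| leq_And2: "And A B \<preceq> B"
| leq_AndR: "C \<preceq> A \<Longrightarrow> C \<preceq> B \<Longrightarrow> C \<preceq> And A B"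
| leq_Star0: "One \<preceq> Star A"
| leq_StarS: "Tens A (Star A) \<preceq> Star A"
| leq_ind: "One \<preceq> B \<Longrightarrow> Tens A B \<preceq> B \<Longrightarrow> Star A \<preceq> B"

declare leq_trans [trans]

lemma leq_refl: "A \<preceq> A"
  by (induction A) (blast intro: leq.intros)+

lemma leq_curry: "Tens A B \<preceq> C \<Longrightarrow> B \<preceq> Imp A C"
  by (meson leq_trans leq_coapp leq_Imp)

lemma leq_uncurry: "B \<preceq> Imp A C \<Longrightarrow> Tens A B \<preceq> C"
  by (meson leq_trans leq_app leq_mono leq_refl)

text \<open>Commutativity reverses the three factors, the postulated direction regroups them, and
  commutativity reverses them back.\<close>

lemma leq_assoc': "Tens A (Tens B C) \<preceq> Tens (Tens A B) C"
proof -
  have "Tens A (Tens B C) \<preceq> Tens (Tens C B) A"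
    by (meson leq_trans leq_comm leq_mono leq_refl)
  also have "Tens (Tens C B) A \<preceq> Tens C (Tens B A)" by (rule leq_assoc)
  also have "Tens C (Tens B A) \<preceq> Tens (Tens A B) C"
    by (meson leq_trans leq_comm leq_mono leq_refl)
  finally show ?thesis .
qed

lemma leq_left_comm: "Tens A (Tens B C) \<preceq> Tens B (Tens A C)"
  by (meson leq_trans leq_comm leq_mono leq_refl leq_assoc leq_assoc')

text \<open>Residuation moves \<open>D\<close> to the right-hand side, where the rule for
  disjunctions applies.\<close>

lemma leq_Tens_Or: "Tens A D \<preceq> C \<Longrightarrow> Tens B D \<preceq> C \<Longrightarrow> Tens (Or A B) D \<preceq> C"
  by (meson leq_trans leq_comm leq_OrL leq_curry leq_uncurry)

section \<open>Antecedents as iterated tensors\<close>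

primrec tens :: "form list \<Rightarrow> form" where
  "tens [] = One"
| "tens (A # As) = Tens A (tens As)"

lemma leq_tens_insert: "tens (A # xs @ ys) \<preceq> tens (xs @ A # ys)"
proof (induction xs)
  case (Cons B xs)
  then show ?case by simp (meson leq_trans leq_left_comm leq_mono leq_refl)
qed (simp add: leq_refl)

lemma leq_tens_perm: "mset xs = mset ys \<Longrightarrow> tens xs \<preceq> tens ys"
proof (induction xs arbitrary: ys)
  case (Cons A xs)
  then have "A \<in> set ys" by (metis list.set_intros(1) set_mset_mset)
  then obtain us vs where ys: "ys = us @ A # vs" by (meson split_list)
  then have "tens xs \<preceq> tens (us @ vs)" using Cons by simp
  then have "tens (A # xs) \<preceq> tens (A # us @ vs)" by (simp add: leq_mono leq_refl)
  then show ?case using leq_trans leq_tens_insert ys by blast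
qed (simp add: leq_refl)

lemma leq_tens_append: "tens (xs @ ys) \<preceq> Tens (tens xs) (tens ys)"
proof (induction xs)
  case (Cons A xs)
  then show ?case by simp (meson leq_trans leq_assoc' leq_mono leq_refl)
qed (simp add: leq_unit1)

text \<open>Any enumeration of the multiset will do, because permuted lists have equivalent
  tensors.\<close>

definition mtens :: "form multiset \<Rightarrow> form" where
  "mtens \<Gamma> = tens (SOME l. mset l = \<Gamma>)"

lemma mtens_mset: "tens l \<preceq> mtens (mset l)" "mtens (mset l) \<preceq> tens l"
proof -
  have "mset (SOME l'. mset l' = mset l) = mset l" by (rule someI[of _ l]) simp
  then show "tens l \<preceq> mtens (mset l)" "mtens (mset l) \<preceq> tens l"
    unfolding mtens_def by (simp_all add: leq_tens_perm)
qed

lemma mtens_empty: "mtens {#} \<preceq> One"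
  using mtens_mset(2)[of "[]"] by simp

lemma mtens_add: "mtens (add_mset A \<Gamma>) \<preceq> Tens A (mtens \<Gamma>)" "Tens A (mtens \<Gamma>) \<preceq> mtens (add_mset A \<Gamma>)"
proof -
  obtain l where l: "mset l = \<Gamma>" by (metis ex_mset)
  show "mtens (add_mset A \<Gamma>) \<preceq> Tens A (mtens \<Gamma>)" "Tens A (mtens \<Gamma>) \<preceq> mtens (add_mset A \<Gamma>)"
    using mtens_mset[of "A # l"] mtens_mset[of l] l
    by simp_all (meson leq_trans leq_mono leq_refl)+
qed

lemma mtens_plus: "mtens (\<Gamma> + \<Delta>) \<preceq> Tens (mtens \<Gamma>) (mtens \<Delta>)"
proof -
  obtain k l where "mset k = \<Gamma>" "mset l = \<Delta>" by (metis ex_mset)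
  then show ?thesis
    using mtens_mset(2)[of "k @ l"] mtens_mset(1)[of k] mtens_mset(1)[of l] leq_tens_append[of k l]
    by simp (meson leq_trans leq_mono leq_refl)
qed

lemma mtens_single: "mtens {#A#} \<preceq> A"
  using mtens_mset(2)[of "[A]"] by simp (meson leq_trans leq_comm leq_unit2)

lemma derivable_imp_leq: "\<Gamma> \<turnstile> C \<Longrightarrow> mtens \<Gamma> \<preceq> C"
proof (induction rule: derivable.induct)
  case (Ax A)
  show ?case by (rule mtens_single)
next
  case (BotL \<Gamma> C)
  show ?case by (meson mtens_add leq_trans leq_comm leq_uncurry leq_Bot)
next
  case OneR
  show ?case by (rule mtens_empty)
next
  case (OneL \<Gamma> C)
  then show ?case by (meson mtens_add leq_trans leq_unit2)
next
  case (ImpL \<Pi> A B \<Gamma> C)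
  have "mtens (add_mset (Imp A B) (\<Gamma> + \<Pi>)) \<preceq> Tens (Imp A B) (Tens (mtens \<Gamma>) (mtens \<Pi>))"
    by (meson mtens_add mtens_plus leq_mono leq_refl leq_trans)
  also have "\<dots> \<preceq> Tens (Imp A B) (Tens (mtens \<Gamma>) A)"
    using ImpL by (intro leq_mono leq_refl)
  also have "\<dots> \<preceq> Tens (mtens \<Gamma>) (Tens (Imp A B) A)" by (rule leq_left_comm)
  also have "\<dots> \<preceq> Tens (mtens \<Gamma>) B"
    by (meson leq_mono leq_refl leq_comm leq_app leq_trans)
  also have "\<dots> \<preceq> C" using ImpL mtens_add leq_comm leq_trans by meson
  finally show ?case .
next
  case (ImpR A \<Pi> B)
  then show ?case by (meson mtens_add leq_trans leq_curry)
next
  case (TensL A B \<Gamma> C)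
  have "mtens (add_mset (Tens A B) \<Gamma>) \<preceq> Tens A (Tens B (mtens \<Gamma>))"
    by (meson mtens_add leq_trans leq_assoc)
  also have "\<dots> \<preceq> C" using TensL by (meson mtens_add leq_trans leq_mono leq_refl)
  finally show ?case .
next
  case (TensR \<Pi> A \<Delta> B)
  then show ?case by (meson mtens_plus leq_trans leq_mono)
next
  case (OrL A \<Gamma> C B)
  then show ?case by (meson mtens_add leq_trans leq_Tens_Or)
next
  case (OrR1 \<Pi> A B)
  then show ?case by (meson leq_trans leq_Or1)
next
  case (OrR2 \<Pi> B A)
  then show ?case by (meson leq_trans leq_Or2)
next
  case (AndL1 A \<Gamma> C B)
  then show ?case by (meson mtens_add leq_trans leq_mono leq_refl leq_And1)
next
  case (AndL2 B \<Gamma> C A)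
  then show ?case by (meson mtens_add leq_trans leq_mono leq_refl leq_And2)
next
  case (AndR \<Pi> A B)
  then show ?case by (meson leq_AndR)
next
  case (Cut \<Pi> A \<Gamma> C)
  have "mtens (\<Gamma> + \<Pi>) \<preceq> Tens (mtens \<Pi>) (mtens \<Gamma>)" by (meson mtens_plus leq_comm leq_trans)
  also have "\<dots> \<preceq> Tens A (mtens \<Gamma>)" using Cut by (intro leq_mono leq_refl)
  also have "\<dots> \<preceq> C" using Cut by (meson mtens_add leq_trans)
  finally show ?case .
next
  case (Star_0 A)
  show ?case by (meson mtens_empty leq_trans leq_Star0)
next
  case (Star_Suc A)
  show ?case by (meson mtens_add mtens_single leq_trans leq_mono leq_refl leq_StarS)
next
  case (Star_ind B A)
  have "One \<preceq> B" using Star_ind(3) mtens_mset(1)[of "[]"] by (simp add: leq_trans)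
  moreover have "Tens A B \<preceq> B"
  proof -
    have "B \<preceq> mtens {#B#}" using mtens_mset(1)[of "[B]"] by simp (meson leq_trans leq_comm leq_unit1)
    then show ?thesis using Star_ind(4) mtens_add(2) by (meson leq_trans leq_mono leq_refl)
  qed
  ultimately show ?case by (meson mtens_single leq_trans leq_ind)
qed

lemma derivable_cut: "\<Gamma> \<turnstile> A \<Longrightarrow> {#A#} \<turnstile> B \<Longrightarrow> \<Gamma> \<turnstile> B"
  using Cut[of \<Gamma> A "{#}" B] by simp

lemma TensL': "{#A, B#} \<turnstile> C \<Longrightarrow> {#Tens A B#} \<turnstile> C"
  using TensL[of A B "{#}" C] by simp

lemma TensR': "{#A#} \<turnstile> C \<Longrightarrow> {#B#} \<turnstile> D \<Longrightarrow> {#A, B#} \<turnstile> Tens C D"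
  using TensR[of "{#A#}" C "{#B#}" D] by (simp add: add_mset_commute)

lemma derivable_app: "{#A, Imp A B#} \<turnstile> B"
  using ImpL[OF Ax[of A], of B "{#}" B] Ax[of B] by (simp add: add_mset_commute)

lemma leq_imp_derivable: "A \<preceq> B \<Longrightarrow> {#A#} \<turnstile> B"
proof (induction rule: leq.induct)
  case (leq_trans A B C)
  then show ?case using derivable_cut by blast
next
  case (leq_mono A B C D)
  then show ?case by (intro TensL' TensR')
next
  case (leq_comm A B)
  show ?case using TensR'[OF Ax[of B] Ax[of A]] by (intro TensL') (simp add: add_mset_commute)
next
  case (leq_assoc A B C)
  have "{#A, B, C#} \<turnstile> Tens A (Tens B C)"
    using TensR[OF Ax[of A] TensR'[OF Ax[of B] Ax[of C]]] by (simp add: add_mset_commute)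
  then have "{#Tens A B, C#} \<turnstile> Tens A (Tens B C)" by (rule TensL)
  then show ?case by (rule TensL')
next
  case (leq_unit1 A)
  show ?case using TensR[OF OneR Ax[of A]] by simp
next
  case (leq_unit2 A)
  show ?case using OneL[OF Ax[of A]] by (rule TensL')
next
  case (leq_app A B)
  show ?case by (intro TensL' derivable_app)
next
  case (leq_coapp B A)
  show ?case using TensR'[OF Ax[of A] Ax[of B]] by (rule ImpR)
next
  case (leq_Imp A B C)
  then have "{#C, Imp C A#} \<turnstile> B" using derivable_cut[OF derivable_app] by blast
  then show ?case by (rule ImpR)
next
  case (leq_OrL A C B)
  then show ?case using OrL[of A "{#}" C B] by simp
next
  case (leq_And1 A B)
  then show ?case using AndL1[of A "{#}" A B] Ax by simp
next
  case (leq_And2 A B)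
  then show ?case using AndL2[of B "{#}" B A] Ax by simp
next
  case (leq_Star0 A)
  show ?case using OneL[OF Star_0] by simp
next
  case (leq_StarS A)
  show ?case by (intro TensL' Star_Suc)
next
  case (leq_ind B A)
  have "{#} \<turnstile> B" using derivable_cut[OF OneR] leq_ind by blast
  moreover have "{#A, B#} \<turnstile> B" using derivable_cut[OF TensR'[OF Ax Ax]] leq_ind by blast
  ultimately show ?case by (rule Star_ind)
qed (auto intro: derivable.intros)

lemma derivable_tens: "mset l \<turnstile> tens l"
proof (induction l)
  case (Cons A l)
  then show ?case using TensR[OF Ax[of A], of "mset l"] by simp
qed (simp add: OneR)

lemma derivable_mset_iff: "mset l \<turnstile> C \<longleftrightarrow> tens l \<preceq> C"
proof
  assume "mset l \<turnstile> C"
  then show "tens l \<preceq> C" using derivable_imp_leq mtens_mset(1) leq_trans by blast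
next
  assume "tens l \<preceq> C"
  then show "mset l \<turnstile> C" using derivable_cut[OF derivable_tens] leq_imp_derivable by blast
qed

subsection \<open>Enumerating the derivable sequents\<close>

text \<open>One step of generating the codes of \<open>\<preceq>\<close>: \<open>k\<close> selects the rule, and formulas that are
  not determined by the premises are read off the left-hand sides of \<open>a\<close>, \<open>b\<close>, \<open>c\<close>. If the
  rule does not apply, \<open>a\<close> is returned.\<close>

definition gen_rule :: "nat \<Rightarrow> nat \<Rightarrow> nat \<Rightarrow> nat \<Rightarrow> nat" where
  "gen_rule k a b c =
   (if k = 0 then (if psnd a = pfst b then pair (pfst a) (psnd b) else a)
    else if k = 1 then pair (pair 4 (pair (pfst a) (pfst b))) (pair 4 (pair (psnd a) (psnd b)))
    else if k = 2 then pair (pair 4 (pair (pfst a) (pfst b))) (pair 4 (pair (pfst b) (pfst a)))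
    else if k = 3 then pair (pair 4 (pair (pair 4 (pair (pfst a) (pfst b))) (pfst c)))
                            (pair 4 (pair (pfst a) (pair 4 (pair (pfst b) (pfst c)))))
    else if k = 4 then pair (pfst a) (pair 4 (pair (pair 2 0) (pfst a)))
    else if k = 5 then pair (pair 4 (pair (pair 2 0) (pfst a))) (pfst a)
    else if k = 6 then pair (pair 4 (pair (pfst a) (pair 3 (pair (pfst a) (pfst b))))) (pfst b)
    else if k = 7 then pair (pfst b) (pair 3 (pair (pfst a) (pair 4 (pair (pfst a) (pfst b)))))
    else if k = 8 then pair (pair 3 (pair (pfst c) (pfst a))) (pair 3 (pair (pfst c) (psnd a)))
    else if k = 9 then pair (pair 1 0) (pfst a)
    else if k = 10 then pair (pfst a) (pair 5 (pair (pfst a) (pfst b)))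
    else if k = 11 then pair (pfst b) (pair 5 (pair (pfst a) (pfst b)))
    else if k = 12 then (if psnd a = psnd b then pair (pair 5 (pair (pfst a) (pfst b))) (psnd a) else a)
    else if k = 13 then pair (pair 6 (pair (pfst a) (pfst b))) (pfst a)
    else if k = 14 then pair (pair 6 (pair (pfst a) (pfst b))) (pfst b)
    else if k = 15 then (if pfst a = pfst b then pair (pfst a) (pair 6 (pair (psnd a) (psnd b))) else a)
    else if k = 16 then pair (pair 2 0) (pair 7 (pfst a))
    else if k = 17 then pair (pair 4 (pair (pfst a) (pair 7 (pfst a)))) (pair 7 (pfst a))
    else if k = 18 then
      (if pfst a = pair 2 0 \<and> pfst b = pair 4 (pair (pfst c) (psnd a)) \<and> psnd b = psnd a
       then pair (pair 7 (pfst c)) (psnd a) else a)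
    else pair (pair 0 (k - 19)) (pair 0 (k - 19)))"

lemma computable_gen_rule:
  "computable (\<lambda>p. gen_rule (pfst p) (pfst (psnd p)) (pfst (psnd (psnd p))) (psnd (psnd (psnd p))))"
  unfolding gen_rule_def by (intro comp_intros computable_id)

definition leq_codes :: "nat set" where
  "leq_codes = {pair (form_code A) (form_code B) |A B. A \<preceq> B}"

lemma leq_codesI: "A \<preceq> B \<Longrightarrow> pair (form_code A) (form_code B) \<in> leq_codes"
  unfolding leq_codes_def by blast

lemma gen_rule_sound:
  assumes "x \<in> leq_codes" "y \<in> leq_codes" "z \<in> leq_codes"
  shows "gen_rule k x y z \<in> leq_codes"
proof -
  obtain A A' B B' C C' where
    x: "x = pair (form_code A) (form_code A')" "A \<preceq> A'" and
    y: "y = pair (form_code B) (form_code B')" "B \<preceq> B'" and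
    z: "z = pair (form_code C) (form_code C')" "C \<preceq> C'"
    using assms unfolding leq_codes_def by blast
  have 0: "A' = B \<Longrightarrow> A \<preceq> B'" and 12: "A' = B' \<Longrightarrow> Or A B \<preceq> A'" and 15: "A = B \<Longrightarrow> A \<preceq> And A' B'"
    and 18: "A = One \<and> B = Tens C A' \<and> B' = A' \<Longrightarrow> Star C \<preceq> A'"
    using x(2) y(2) by (auto intro: leq_trans leq_OrL leq_AndR leq_ind)
  have if_in: "(P \<Longrightarrow> m \<in> leq_codes) \<Longrightarrow> (\<not> P \<Longrightarrow> n \<in> leq_codes) \<Longrightarrow> (if P then m else n) \<in> leq_codes" for P m n
    by simp
  show ?thesis
    \<comment> \<open>Numbers are folded back into codes of formulas and equations between codes
      into equations between formulas; every branch then is an instance of a rule of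
      \<open>\<preceq>\<close>.\<close>
    unfolding gen_rule_def x(1) y(1) z(1) prod_encode_inverse fst_conv snd_conv
      form_code.simps[symmetric] form_code_inject
    by (intro if_in leq_codesI; (erule 0 12 15 18 | rule x(2) leq_mono[OF x(2) y(2)] leq_comm leq_assoc
       leq_unit1 leq_unit2 leq_app leq_coapp leq_Imp[OF x(2)] leq_Bot leq_Or1 leq_Or2
       leq_And1 leq_And2 leq_Star0 leq_StarS leq_Var))
qed

lemma generated_gen_rule: "generated gen_rule (pair (pair 2 0) (pair 2 0)) = leq_codes" (is "?G = _")
proof
  have one: "pair (pair 2 0) (pair 2 0) \<in> leq_codes" using leq_codesI[OF leq_One] by simp
  have "x \<in> leq_codes" if "x \<in> ?G" for x
    using that by induction (auto intro: one gen_rule_sound)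
  then show "?G \<subseteq> leq_codes" by blast
next
  have gen: "gen_rule k x y z \<in> ?G" if "x \<in> ?G" "y \<in> ?G" "z \<in> ?G" for k x y z
    using that by (rule generated.step)
  let ?c = "\<lambda>A B. pair (form_code A) (form_code B)"
  have one: "?c One One \<in> ?G" using generated.base[of "pair (pair 2 0) (pair 2 0)" gen_rule] by simp

  have trans: "?c A C \<in> ?G" if "?c A B \<in> ?G" "?c B C \<in> ?G" for A B C
    using gen[OF that one, of 0] by (simp add: gen_rule_def[of 0])
  have mono: "?c (Tens A C) (Tens B D) \<in> ?G" if "?c A B \<in> ?G" "?c C D \<in> ?G" for A B C D
    using gen[OF that one, of 1] by (simp add: gen_rule_def[of "Suc 0"])
  have Imp_mono: "?c (Imp C A) (Imp C B) \<in> ?G" if "?c A B \<in> ?G" "?c C C \<in> ?G" for A B C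
    using gen[OF that(1) one that(2), of 8] by (simp add: gen_rule_def[of 8])
  have OrL: "?c (Or A B) C \<in> ?G" if "?c A C \<in> ?G" "?c B C \<in> ?G" for A B C
    using gen[OF that one, of 12] by (simp add: gen_rule_def[of 12])
  have AndR: "?c C (And A B) \<in> ?G" if "?c C A \<in> ?G" "?c C B \<in> ?G" for A B C
    using gen[OF that one, of 15] by (simp add: gen_rule_def[of 15])
  have ind: "?c (Star A) B \<in> ?G" if "?c One B \<in> ?G" "?c (Tens A B) B \<in> ?G" "?c A A \<in> ?G" for A B
    using gen[OF that, of 18] by (simp add: gen_rule_def[of 18])
  have Var_refl: "?c (Var n) (Var n) \<in> ?G" for n
    using gen[OF one one one, of "n + 19"] by (simp add: gen_rule_def)
  \<comment> \<open>This turns every formula into the left-hand side of a generated pair, which is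
    where the axioms take their formulas from.\<close>
  have refl: "?c A A \<in> ?G" for A
  proof (induction A)
    case (Var n)
    show ?case by (rule Var_refl)
  next
    case Bot
    \<comment> \<open>Rule 9 copies a left-hand side to the right. Its first use makes
      \<open>Bot\<close> a left-hand side, its second copies it.\<close>
    have "?c Bot One \<in> ?G" using gen[OF one one one, of 9] by (simp add: gen_rule_def[of 9])
    from gen[OF this one one, of 9] show ?case by (simp add: gen_rule_def[of 9])
  next
    case One
    show ?case by (rule one)
  next
    case (Imp A B)
    show ?case by (rule Imp_mono; fact)
  next
    case (Tens A B)
    show ?case by (rule mono; fact)
  next
    case (Or A B)
    show ?case using gen[OF Or one, of 10] gen[OF Or one, of 11] by (intro OrL) (simp_all add: gen_rule_def[of 10] gen_rule_def[of 11])
  next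
    case (And A B)
    show ?case using gen[OF And one, of 13] gen[OF And one, of 14] by (intro AndR) (simp_all add: gen_rule_def[of 13] gen_rule_def[of 14])
  next
    case (Star A)
    show ?case using gen[OF Star one one, of 16] gen[OF Star one one, of 17] Star
      by (intro ind) (simp_all add: gen_rule_def[of 16] gen_rule_def[of 17])
  qed
  note ax = gen[OF refl refl refl]
  have "?c A B \<in> ?G" if "A \<preceq> B" for A B
    using that
  proof induction
    case (leq_trans A B C) show ?case by (rule trans; fact)
  next
    case (leq_mono A B C D) show ?case by (rule mono; fact)
  next
    case (leq_Imp A B C) show ?case by (rule Imp_mono[OF leq_Imp.IH refl])
  next
    case (leq_OrL A B C) show ?case by (rule OrL; fact)
  next
    case (leq_AndR A B C) show ?case by (rule AndR; fact)
  next
    case (leq_ind A B) show ?case by (rule ind[OF leq_ind.IH refl])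
  next
    case (leq_comm A B) show ?case using ax[of 2 A B One] by (simp add: gen_rule_def[of 2])
  next
    case (leq_assoc A B C) show ?case using ax[of 3 A B C] by (simp add: gen_rule_def[of 3])
  next
    case (leq_unit1 A) show ?case using ax[of 4 A One One] by (simp add: gen_rule_def[of 4])
  next
    case (leq_unit2 A) show ?case using ax[of 5 A One One] by (simp add: gen_rule_def[of 5])
  next
    case (leq_app A B) show ?case using ax[of 6 A B One] by (simp add: gen_rule_def[of 6])
  next
    case (leq_coapp B A) show ?case using ax[of 7 A B One] by (simp add: gen_rule_def[of 7])
  next
    case (leq_Bot A) show ?case using ax[of 9 A One One] by (simp add: gen_rule_def[of 9])
  next
    case (leq_Or1 A B) show ?case using ax[of 10 A B One] by (simp add: gen_rule_def[of 10])
  next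
    case (leq_Or2 B A) show ?case using ax[of 11 A B One] by (simp add: gen_rule_def[of 11])
  next
    case (leq_And1 A B) show ?case using ax[of 13 A B One] by (simp add: gen_rule_def[of 13])
  next
    case (leq_And2 A B) show ?case using ax[of 14 A B One] by (simp add: gen_rule_def[of 14])
  next
    case (leq_Star0 A) show ?case using ax[of 16 A One One] by (simp add: gen_rule_def[of 16])
  next
    case (leq_StarS A) show ?case using ax[of 17 A One One] by (simp add: gen_rule_def[of 17])
  qed (rule one Var_refl)+
  then show "leq_codes \<subseteq> ?G" unfolding leq_codes_def by blast
qed

section \<open>Recognizing the codes of derivable sequents\<close>

definition tens_code :: "nat list \<Rightarrow> nat" where
  "tens_code xs = fold (\<lambda>a c. pair 4 (pair a c)) xs (pair 2 0)"

text \<open>The fold puts the last entry outermost and thus reverses the list, which is harmless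
  because antecedents are multisets.\<close>

lemma tens_code_form_codes: "tens_code (map form_code l) = form_code (tens (rev l))"
  by (induction l rule: rev_induct) (simp_all add: tens_code_def)

text \<open>This is why membership of the tensor in \<open>leq_codes\<close> already guarantees that
  all entries of the list are codes of formulas.\<close>

lemma tens_code_eq_form_code:
  "tens_code xs = form_code D \<Longrightarrow> \<exists>l. xs = map form_code l"
proof (induction xs arbitrary: D rule: rev_induct)
  case (snoc x xs)
  then have "pair 4 (pair x (tens_code xs)) = form_code D" by (simp add: tens_code_def)
  then obtain A B where "x = form_code A" "tens_code xs = form_code B" by (cases D) auto
  with snoc.IH obtain l where "xs = map form_code l" by blast
  then have "xs @ [x] = map form_code (l @ [A])" using \<open>x = form_code A\<close> by simp
  then show ?case by blast
qed simp

text \<open>The accumulator is \<open>Suc\<close> of the previous entry, and \<open>0\<close> once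
  the order has been violated.\<close>

lemma fold_sorted:
  "fold (\<lambda>x a. if a = 0 then 0 else if a - 1 \<le> x then Suc x else 0) xs (Suc m) \<noteq> 0 \<longleftrightarrow> sorted (m # xs)"
proof (induction xs arbitrary: m)
  case (Cons x xs)
  have "fold (\<lambda>x a. if a = 0 then 0 else if a - 1 \<le> x then Suc x else 0) xs 0 = 0" for xs :: "nat list"
    by (induction xs) auto
  then show ?case using Cons by auto
qed simp

text \<open>Sortedness singles out the canonical list among those representing the same antecedent;
  derivability is then a matter of the tensor of its entries.\<close>

lemma sequent_code_theorem_iff:
  "s \<in> sequent_code ` CommACT_theorems \<longleftrightarrow>
    sorted (list_decode (pfst s)) \<and> pair (tens_code (list_decode (pfst s))) (psnd s) \<in> leq_codes"
proof
  assume "s \<in> sequent_code ` CommACT_theorems"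
  then obtain \<Gamma> C where \<Gamma>: "\<Gamma> \<turnstile> C" and s: "s = sequent_code (\<Gamma>, C)"
    unfolding CommACT_theorems_def by auto
  define xs where "xs = sorted_list_of_multiset (image_mset form_code \<Gamma>)"
  have mset_xs: "mset xs = image_mset form_code \<Gamma>" by (simp add: xs_def)
  then have "set xs \<subseteq> range form_code" by (metis image_mono set_image_mset set_mset_mset subset_UNIV)
  then obtain l where l: "xs = map form_code l" by (metis ex_map_conv rangeE subset_iff)
  have "inj (image_mset form_code)" by (rule multiset.inj_map) (simp add: inj_def form_code_inject)
  then have "mset l = \<Gamma>" using mset_xs l by (auto dest: injD)
  then have "tens (rev l) \<preceq> C" using \<Gamma> derivable_mset_iff[of "rev l"] by simp
  then have "pair (tens_code xs) (form_code C) \<in> leq_codes"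
    unfolding l tens_code_form_codes by (rule leq_codesI)
  moreover have "list_decode (pfst s) = xs" "psnd s = form_code C" "sorted xs"
    by (simp_all add: s sequent_code_def xs_def)
  ultimately show "sorted (list_decode (pfst s)) \<and> pair (tens_code (list_decode (pfst s))) (psnd s) \<in> leq_codes"
    by simp
next
  assume *: "sorted (list_decode (pfst s)) \<and> pair (tens_code (list_decode (pfst s))) (psnd s) \<in> leq_codes"
  then obtain D C where D: "tens_code (list_decode (pfst s)) = form_code D" "psnd s = form_code C" "D \<preceq> C"
    unfolding leq_codes_def by auto
  then obtain l where l: "list_decode (pfst s) = map form_code l" using tens_code_eq_form_code by blast
  have "D = tens (rev l)" using D(1) tens_code_form_codes form_code_inject l by metis
  then have "mset l \<turnstile> C" using D(3) derivable_mset_iff[of "rev l"] by simp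
  moreover have "s = sequent_code (mset l, C)"
  proof -
    have "sorted_list_of_multiset (mset (map form_code l)) = map form_code l"
      using * l by (metis sorted_list_of_multiset_mset sorted_sort_id)
    then have "sequent_code (mset l, C) = pair (list_encode (list_decode (pfst s))) (psnd s)"
      by (simp add: sequent_code_def l D(2))
    then show ?thesis by simp
  qed
  ultimately show "s \<in> sequent_code ` CommACT_theorems" unfolding CommACT_theorems_def by blast
qed

lemma CommACT_theorems_re: "recursively_enumerable (sequent_code ` CommACT_theorems)"
proof -
  let ?e = "gen_enum gen_rule (pair (pair 2 0) (pair 2 0))"
  \<comment> \<open>The start value \<open>Suc 0\<close> acts as a previous entry \<open>0\<close>,
    below every number.\<close>
  let ?P = "\<lambda>p. fold (\<lambda>x a. if a = 0 then 0 else if a - 1 \<le> x then Suc x else 0)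
      (list_decode (pfst (psnd p))) (Suc 0) \<noteq> 0 \<and>
    ?e (pfst p) = pair (tens_code (list_decode (pfst (psnd p)))) (psnd (psnd p))"
  have "decidable ?P"
    unfolding tens_code_def
    by (intro comp_intros computable_fold computable_id computable_compose[OF computable_gen_enum[OF computable_gen_rule]])
  moreover have "s \<in> sequent_code ` CommACT_theorems \<longleftrightarrow> (\<exists>t. ?P (pair t s))" for s
    unfolding sequent_code_theorem_iff generated_gen_rule[symmetric] range_gen_enum[symmetric] fold_sorted
    by (auto, metis rangeI)
  ultimately show ?thesis unfolding recursively_enumerable_iff by blast
qed

section \<open>Register machines\<close>

text \<open>\<open>Loop r b\<close> decrements \<open>r\<close> and runs \<open>b\<close> as long as \<open>r\<close> is positive. A configuration
  consists of the commands still to be executed and the registers, where register \<open>r\<close> holds its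
  multiplicity in the multiset.\<close>

datatype cmd = Inc nat | Loop nat "cmd list"

inductive step :: "cmd list \<times> nat multiset \<Rightarrow> cmd list \<times> nat multiset \<Rightarrow> bool" where
  step_Inc: "step (Inc r # k, \<rho>) (k, add_mset r \<rho>)"
| step_Loop: "step (Loop r b # k, add_mset r \<rho>) (b @ Loop r b # k, \<rho>)"
| step_Exit: "r \<notin># \<rho> \<Longrightarrow> step (Loop r b # k, \<rho>) (k, \<rho>)"

lemma step_deterministic: "step c d \<Longrightarrow> step c e \<Longrightarrow> d = e"
  by (auto elim!: step.cases)

text \<open>Quantifying over the continuation \<open>k\<close> makes programs composable and lets
  them serve as loop bodies.\<close>

definition exec :: "cmd list \<Rightarrow> nat multiset \<Rightarrow> nat multiset \<Rightarrow> bool" where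
  "exec p \<rho> \<rho>' \<longleftrightarrow> (\<forall>k. step\<^sup>*\<^sup>* (p @ k, \<rho>) (k, \<rho>'))"

lemma exec_Nil: "exec [] \<rho> \<rho>"
  by (simp add: exec_def)

lemma exec_append: "exec p \<rho> \<rho>' \<Longrightarrow> exec q \<rho>' \<rho>'' \<Longrightarrow> exec (p @ q) \<rho> \<rho>''"
  unfolding exec_def by (metis append_assoc rtranclp_trans)

lemma exec_Cons: "exec [c] \<rho> \<rho>' \<Longrightarrow> exec q \<rho>' \<rho>'' \<Longrightarrow> exec (c # q) \<rho> \<rho>''"
  using exec_append[of "[c]"] by simp

text \<open>The remainder is nonempty, so that repeated application stops at single
  commands.\<close>

lemma exec_Cons2: "exec [c] \<rho> \<rho>' \<Longrightarrow> exec (d # q) \<rho>' \<rho>'' \<Longrightarrow> exec (c # d # q) \<rho> \<rho>''"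
  by (rule exec_Cons)

lemma exec_Inc: "exec [Inc r] \<rho> (add_mset r \<rho>)"
  unfolding exec_def using step_Inc by auto

lemma exec_Loop_exit: "r \<notin># \<rho> \<Longrightarrow> exec [Loop r b] \<rho> \<rho>"
  unfolding exec_def using step_Exit by auto

lemma exec_Loop_step: "exec b \<rho> \<rho>' \<Longrightarrow> exec [Loop r b] \<rho>' \<rho>'' \<Longrightarrow> exec [Loop r b] (add_mset r \<rho>) \<rho>''"
  unfolding exec_def
  by (metis append_Cons append_Nil converse_rtranclp_into_rtranclp rtranclp_trans step_Loop)

section \<open>Clearing, moving and copying registers\<close>

abbreviation reg :: "nat \<Rightarrow> nat \<Rightarrow> nat multiset" where
  "reg r n \<equiv> replicate_mset n r"

lemma exec_clear: "r \<notin># \<rho> \<Longrightarrow> exec [Loop r []] (\<rho> + reg r n) \<rho>"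
proof (induction n)
  case (Suc n)
  then show ?case using exec_Loop_step[OF exec_Nil[of "\<rho> + reg r n"], of r \<rho>] by simp
qed (simp add: exec_Loop_exit)

lemma exec_move: "a \<notin># \<rho> \<Longrightarrow> a \<noteq> b \<Longrightarrow> exec [Loop a [Inc b]] (\<rho> + reg a n) (\<rho> + reg b n)"
proof (induction n arbitrary: \<rho>)
  case (Suc n)
  have "exec [Loop a [Inc b]] (add_mset b \<rho> + reg a n) (add_mset b \<rho> + reg b n)"
    using Suc by (intro Suc.IH) auto
  with exec_Inc[of b "\<rho> + reg a n"] show ?case
    using exec_Loop_step[of "[Inc b]" "\<rho> + reg a n"] by simp
qed (simp add: exec_Loop_exit)

lemma exec_move2:
  "a \<notin># \<rho> \<Longrightarrow> a \<noteq> b \<Longrightarrow> a \<noteq> c \<Longrightarrow> exec [Loop a [Inc b, Inc c]] (\<rho> + reg a n) (\<rho> + reg b n + reg c n)"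
proof (induction n arbitrary: \<rho>)
  case (Suc n)
  have "exec [Loop a [Inc b, Inc c]] (add_mset c (add_mset b \<rho>) + reg a n) (add_mset c (add_mset b \<rho>) + reg b n + reg c n)"
    using Suc by (intro Suc.IH) auto
  moreover have "exec [Inc b, Inc c] (\<rho> + reg a n) (add_mset c (add_mset b (\<rho> + reg a n)))"
    using exec_Cons[OF exec_Inc exec_Inc] .
  ultimately show ?case
    using exec_Loop_step[of "[Inc b, Inc c]" "\<rho> + reg a n"] by (simp add: add_mset_commute)
qed (simp add: exec_Loop_exit)

text \<open>Reading a register empties it; the scratch register \<open>t\<close> keeps a second copy
  from which it is restored.\<close>

definition copy :: "nat \<Rightarrow> nat \<Rightarrow> nat \<Rightarrow> cmd list" where
  "copy a b t = [Loop a [Inc b, Inc t], Loop t [Inc a]]"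

lemma exec_copy:
  assumes "a \<noteq> b" "a \<noteq> t" "b \<noteq> t" "t \<notin># \<rho>"
  shows "exec (copy a b t) \<rho> (\<rho> + reg b (count \<rho> a))"
proof -
  define \<rho>0 n where "\<rho>0 = filter_mset (\<lambda>r. r \<noteq> a) \<rho>" and "n = count \<rho> a"
  have \<rho>: "\<rho> = \<rho>0 + reg a n" unfolding \<rho>0_def n_def by (auto simp: multiset_eq_iff)
  have a: "a \<notin># \<rho>0" by (simp add: \<rho>0_def)
  have t: "t \<notin># \<rho>0 + reg b n" using assms \<rho> by auto
  have "exec (copy a b t) (\<rho>0 + reg a n) (\<rho>0 + reg b n + reg a n)"
    unfolding copy_def using exec_move2[OF a assms(1,2)] exec_move[OF t, of a] assms(2)
    by (blast intro: exec_Cons)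
  moreover have "count \<rho>0 a = 0" using a by (simp add: count_eq_zero_iff)
  ultimately show ?thesis unfolding \<rho> by (simp add: ac_simps)
qed

section \<open>Compilation of recursive functions\<close>

primrec comp_seq :: "(nat list \<Rightarrow> nat \<Rightarrow> nat \<Rightarrow> cmd list) list \<Rightarrow> nat list \<Rightarrow> nat \<Rightarrow> nat \<Rightarrow> cmd list" where
  "comp_seq [] ins a m = []"
| "comp_seq (c # cs) ins a m = c ins a m @ comp_seq cs ins (Suc a) m"

text \<open>\<open>compile f ins out m\<close> adds the value of \<open>f\<close> on the registers \<open>ins\<close> to register \<open>out\<close>, using
  as scratch space the registers from \<open>m\<close> on, which have to be \<open>0\<close>.\<close>

primrec compile :: "recf \<Rightarrow> nat list \<Rightarrow> nat \<Rightarrow> nat \<Rightarrow> cmd list" where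
  "compile Zero = (\<lambda>ins out m. [])"
| "compile Succ = (\<lambda>ins out m. copy (hd ins) out m @ [Inc out])"
| "compile (Proj i) = (\<lambda>ins out m. copy (ins ! i) out m)"
| "compile (Comp f gs) = (\<lambda>ins out m. let m' = m + length gs in
     comp_seq (map compile gs) ins m m' @ compile f [m..<m'] out m' @ map (\<lambda>r. Loop r []) [m..<m'])"
| "compile (PrimRec f g) = (\<lambda>ins out m.
     copy (hd ins) m (Suc m) @ compile f (tl ins) (m + 2) (m + 4) @
     [Loop m (compile g ((m + 1) # (m + 2) # tl ins) (m + 3) (m + 4) @
        [Loop (m + 2) [], Loop (m + 3) [Inc (m + 2)], Inc (m + 1)]),
      Loop (m + 2) [Inc out], Loop (m + 1) []])"
| "compile (Mu f) = (\<lambda>ins out m.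
     compile f (m # ins) (m + 1) (m + 2) @
     [Loop (m + 1) ([Loop (m + 1) [], Inc m] @ compile f (m # ins) (m + 1) (m + 2)),
      Loop m [Inc out]])"

primrec regs :: "nat \<Rightarrow> nat list \<Rightarrow> nat multiset" where
  "regs a [] = {#}"
| "regs a (y # ys) = reg a y + regs (Suc a) ys"

lemma count_regs: "count (regs a ys) r = (if a \<le> r \<and> r < a + length ys then ys ! (r - a) else 0)"
  by (induction ys arbitrary: a) (auto simp: nth_Cons')

lemma set_mset_regs: "r \<in># regs a ys \<Longrightarrow> a \<le> r \<and> r < a + length ys"
proof (induction ys arbitrary: a)
  case (Cons y ys)
  then consider "r = a" | "r \<in># regs (Suc a) ys" by (auto split: if_splits)
  then show ?case using Cons.IH[of "Suc a"] by cases auto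
qed simp

lemma exec_clears:
  "\<forall>r\<in>{a..<a + length ys}. r \<notin># \<rho> \<Longrightarrow> exec (map (\<lambda>r. Loop r []) [a..<a + length ys]) (\<rho> + regs a ys) \<rho>"
proof (induction ys arbitrary: a)
  case (Cons y ys)
  have "a \<notin># \<rho>" using Cons.prems by simp
  moreover have "a \<notin># regs (Suc a) ys" using set_mset_regs[of a "Suc a" ys] by auto
  ultimately have "exec [Loop a []] (\<rho> + regs (Suc a) ys + reg a y) (\<rho> + regs (Suc a) ys)"
    by (intro exec_clear) simp
  moreover have "exec (map (\<lambda>r. Loop r []) [Suc a..<Suc a + length ys]) (\<rho> + regs (Suc a) ys) \<rho>"
    using Cons.prems by (intro Cons.IH) simp
  moreover have "[a..<a + length (y # ys)] = a # [Suc a..<Suc a + length ys]"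
    by (subst upt_conv_Cons) simp_all
  moreover have "\<rho> + regs a (y # ys) = \<rho> + regs (Suc a) ys + reg a y" by (simp add: ac_simps)
  ultimately show ?case by (simp only: list.map exec_Cons)
qed (simp add: exec_Nil)

text \<open>As the final contents are \<open>\<rho> + reg out y\<close>, inputs are restored and
  scratch registers are empty again, so compiled programs can be chained and iterated.\<close>

definition compiles :: "(nat list \<Rightarrow> nat \<Rightarrow> nat \<Rightarrow> cmd list) \<Rightarrow> nat list \<Rightarrow> nat \<Rightarrow> bool" where
  "compiles c xs y \<longleftrightarrow> (\<forall>ins out m \<rho>. map (count \<rho>) ins = xs \<longrightarrow> (\<forall>i\<in>set ins. i < m \<and> i \<noteq> out) \<longrightarrow> out < m \<longrightarrow>
     (\<forall>r\<ge>m. r \<notin># \<rho>) \<longrightarrow> exec (c ins out m) \<rho> (\<rho> + reg out y))"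

lemma compilesD:
  assumes "compiles c xs y" "map (count \<rho>) ins = xs" "\<And>i. i \<in> set ins \<Longrightarrow> i < m \<and> i \<noteq> out" "out < m"
    "\<And>r. r \<ge> m \<Longrightarrow> r \<notin># \<rho>"
  shows "exec (c ins out m) \<rho> (\<rho> + reg out y)"
  using assms unfolding compiles_def by blast

lemma exec_comp_seq:
  assumes "list_all2 (\<lambda>c y. compiles c xs y) cs ys"
    "map (count \<rho>) ins = xs" "\<forall>i\<in>set ins. i < a" "a + length cs \<le> m" "\<forall>r\<ge>m. r \<notin># \<rho>"
  shows "exec (comp_seq cs ins a m) \<rho> (\<rho> + regs a ys)"
  using assms
proof (induction arbitrary: a \<rho> rule: list_all2_induct)
  case (Cons c cs y ys)
  have "exec (c ins a m) \<rho> (\<rho> + reg a y)"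
  proof (rule compilesD[OF Cons.hyps(1) Cons.prems(1)])
    fix i assume "i \<in> set ins"
    then show "i < m \<and> i \<noteq> a" using Cons.prems(2,3) by fastforce
  qed (use Cons.prems in auto)
  moreover have "exec (comp_seq cs ins (Suc a) m) (\<rho> + reg a y) (\<rho> + reg a y + regs (Suc a) ys)"
    using Cons.prems by (intro Cons.IH) (auto simp: less_Suc_eq)
  ultimately show ?case by (auto intro: exec_append simp: ac_simps)
qed (simp add: exec_Nil)

lemma map_count_regs:
  "\<forall>r\<in>{a..<a + length ys}. r \<notin># \<rho> \<Longrightarrow> map (count (\<rho> + regs a ys)) [a..<a + length ys] = ys"
  by (intro nth_equalityI) (auto simp: count_regs count_eq_zero_iff)

text \<open>Evaluation unfolds the recursion downwards, whereas the compiled loop counts upwards;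
  the sequence of intermediate values serves both.\<close>

lemma PrimRec_values:
  assumes "rec_eval (PrimRec f g) (n # xs) y"
  obtains v where "rec_eval f xs (v 0)" "\<And>i. i < n \<Longrightarrow> rec_eval g (i # v i # xs) (v (Suc i))" "v n = y"
proof -
  have "\<exists>v. rec_eval f xs (v 0) \<and> (\<forall>i<n. rec_eval g (i # v i # xs) (v (Suc i))) \<and> v n = y"
    using assms
  proof (induction n arbitrary: y)
    case 0
    then show ?case by (auto elim: rec_PrimRec_0E)
  next
    case (Suc n)
    from Suc.prems obtain z where z: "rec_eval (PrimRec f g) (n # xs) z" "rec_eval g (n # z # xs) y"
      by (rule rec_PrimRec_SucE)
    from Suc.IH[OF z(1)] obtain v where
      "rec_eval f xs (v 0)" "\<forall>i<n. rec_eval g (i # v i # xs) (v (Suc i))" "v n = z" by blast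
    then show ?case using z(2) by (intro exI[of _ "v(Suc n := y)"]) (auto simp: less_Suc_eq)
  qed
  then show ?thesis using that by blast
qed

text \<open>Only converging evaluations are described: a machine is run below only if its search is
  known to succeed.\<close>

lemma compile_correct: "rec_eval f xs y \<Longrightarrow> compiles (compile f) xs y"
proof (induction f arbitrary: xs y)
  case Zero
  then have "y = 0" by (rule rec_ZeroE) simp
  then show ?case by (simp add: compiles_def exec_Nil)
next
  case Succ
  then obtain x where x: "xs = [x]" "y = Suc x" by (rule rec_SuccE) auto
  show ?case unfolding compiles_def
  proof (intro allI impI)
    fix ins out m and \<rho> :: "nat multiset"
    assume a: "map (count \<rho>) ins = xs" "\<forall>i\<in>set ins. i < m \<and> i \<noteq> out" "out < m" "\<forall>r\<ge>m. r \<notin># \<rho>"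
    then obtain i where i: "ins = [i]" "count \<rho> i = x" using x by auto
    have "exec (copy i out m) \<rho> (\<rho> + reg out (count \<rho> i))"
      using a i by (intro exec_copy) auto
    from exec_append[OF this exec_Inc[of out]]
    show "exec (compile Succ ins out m) \<rho> (\<rho> + reg out y)" using i x by simp
  qed
next
  case (Proj j)
  then have j: "j < length xs" "y = xs ! j" by (auto elim: rec_ProjE)
  show ?case unfolding compiles_def
  proof (intro allI impI)
    fix ins out m and \<rho> :: "nat multiset"
    assume a: "map (count \<rho>) ins = xs" "\<forall>i\<in>set ins. i < m \<and> i \<noteq> out" "out < m" "\<forall>r\<ge>m. r \<notin># \<rho>"
    then have "count \<rho> (ins ! j) = y" "ins ! j \<in> set ins" using j by auto
    then show "exec (compile (Proj j) ins out m) \<rho> (\<rho> + reg out y)"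
      using exec_copy[of "ins ! j" out m \<rho>] a by auto
  qed
next
  case (Comp f gs)
  then obtain ys where ys: "list_all2 (\<lambda>g y. rec_eval g xs y) gs ys" "rec_eval f ys y" by (elim rec_CompE)
  then have len: "length ys = length gs" by (simp add: list_all2_lengthD)
  show ?case unfolding compiles_def
  proof (intro allI impI)
    fix ins out m and \<rho> :: "nat multiset"
    assume a: "map (count \<rho>) ins = xs" "\<forall>i\<in>set ins. i < m \<and> i \<noteq> out" "out < m" "\<forall>r\<ge>m. r \<notin># \<rho>"
    let ?m = "m + length gs"
    have "list_all2 (\<lambda>c y. compiles c xs y) (map compile gs) ys"
      using ys(1) Comp.IH(2) by (simp add: list_all2_conv_all_nth)
    then have "exec (comp_seq (map compile gs) ins m ?m) \<rho> (\<rho> + regs m ys)"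
      using a by (intro exec_comp_seq) auto
    moreover have "exec (compile f [m..<?m] out ?m) (\<rho> + regs m ys) (\<rho> + regs m ys + reg out y)"
      using map_count_regs[of m ys \<rho>] a len
      by (intro compilesD[OF Comp.IH(1)[OF ys(2)]]) (auto dest: set_mset_regs)
    moreover have "exec (map (\<lambda>r. Loop r []) [m..<?m]) (\<rho> + regs m ys + reg out y) (\<rho> + reg out y)"
      using exec_clears[of m ys "\<rho> + reg out y"] a len by (auto simp: ac_simps)
    ultimately show "exec (compile (Comp f gs) ins out m) \<rho> (\<rho> + reg out y)"
      by (auto simp: Let_def intro: exec_append)
  qed
next
  case (PrimRec f g)
  obtain n ys where xs: "xs = n # ys" using PrimRec.prems by (cases rule: rec_eval.cases) auto
  obtain v where v: "rec_eval f ys (v 0)" "\<And>i. i < n \<Longrightarrow> rec_eval g (i # v i # ys) (v (Suc i))" "v n = y"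
    using PrimRec_values PrimRec.prems unfolding xs by blast
  show ?case unfolding compiles_def
  proof (intro allI impI)
    fix ins out m and \<rho> :: "nat multiset"
    assume a: "map (count \<rho>) ins = xs" "\<forall>i\<in>set ins. i < m \<and> i \<noteq> out" "out < m" "\<forall>r\<ge>m. r \<notin># \<rho>"
    obtain c cs where cs: "ins = c # cs" "count \<rho> c = n" "map (count \<rho>) cs = ys"
      using a(1) xs by (cases ins) auto
    have m: "c < m" "c \<noteq> out" "\<forall>i\<in>set cs. i < m \<and> i \<noteq> out" using a(2) cs by auto
    have 0: "count \<rho> m = 0" "count \<rho> (Suc m) = 0" "count \<rho> (m + 2) = 0" "count \<rho> (m + 3) = 0"
      using a(4) by (simp_all add: count_eq_zero_iff)
    have cnt: "map (count (\<rho> + \<sigma>)) cs = ys" if "\<forall>r<m. r \<notin># \<sigma>" for \<sigma>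
      using cs(3) m(3) that by (auto simp: count_eq_zero_iff)
    let ?body = "compile g ((m + 1) # (m + 2) # cs) (m + 3) (m + 4) @
        [Loop (m + 2) [], Loop (m + 3) [Inc (m + 2)], Inc (m + 1)]"
    \<comment> \<open>Register \<open>m\<close> counts the rounds left, \<open>m + 1\<close> holds
      the index and \<open>m + 2\<close> the value reached; \<open>m + 3\<close> receives the next
      value before it replaces the old one.\<close>
    let ?S = "\<lambda>k i. \<rho> + reg m k + reg (m + 1) i + reg (m + 2) (v i)"
    have body: "exec ?body (?S k i) (?S k (Suc i))" if i: "i < n" for k i
    proof -
      have "exec (compile g ((m + 1) # (m + 2) # cs) (m + 3) (m + 4)) (?S k i) (?S k i + reg (m + 3) (v (Suc i)))"
      proof (rule compilesD[OF PrimRec.IH(2)[OF v(2)[OF i]]])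
        show "map (count (?S k i)) ((m + 1) # (m + 2) # cs) = i # v i # ys"
          using 0 cnt[of "reg m k + reg (m + 1) i + reg (m + 2) (v i)"] by (simp add: ac_simps)
        show "r \<notin># ?S k i" if "r \<ge> m + 4" for r using a(4) that by simp
      qed (use m(3) in auto)
      moreover have "exec [Loop (m + 2) []] (?S k i + reg (m + 3) (v (Suc i)))
          (\<rho> + reg m k + reg (m + 1) i + reg (m + 3) (v (Suc i)))"
        using exec_clear[of "m + 2" "\<rho> + reg m k + reg (m + 1) i + reg (m + 3) (v (Suc i))" "v i"] a(4)
        by (auto simp: ac_simps)
      moreover have "exec [Loop (m + 3) [Inc (m + 2)]] (\<rho> + reg m k + reg (m + 1) i + reg (m + 3) (v (Suc i)))
          (\<rho> + reg m k + reg (m + 1) i + reg (m + 2) (v (Suc i)))"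
        using a(4) by (intro exec_move) auto
      moreover have "exec [Inc (m + 1)] (\<rho> + reg m k + reg (m + 1) i + reg (m + 2) (v (Suc i))) (?S k (Suc i))"
        using exec_Inc[of "m + 1"] by (simp add: ac_simps)
      ultimately show ?thesis by - (assumption | rule exec_append exec_Cons2)+
    qed
    have loop: "i + k = n \<Longrightarrow> exec [Loop m ?body] (?S k i) (?S 0 n)" for k i
    proof (induction k arbitrary: i)
      case 0
      then show ?case using a(4) by (auto intro!: exec_Loop_exit split: if_splits)
    next
      case (Suc k)
      have "exec [Loop m ?body] (?S k (Suc i)) (?S 0 n)" by (rule Suc.IH) (use Suc.prems in simp)
      moreover have "i < n" using Suc.prems by simp
      ultimately have "exec [Loop m ?body] (add_mset m (?S k i)) (?S 0 n)"
        using exec_Loop_step[OF body] by blast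
      then show ?case by simp
    qed
    have "exec (copy c m (Suc m)) \<rho> (\<rho> + reg m n)"
      using exec_copy[of c m "Suc m" \<rho>] a(4) m cs(2) by auto
    moreover have "exec (compile f cs (m + 2) (m + 4)) (\<rho> + reg m n) (?S n 0)"
    proof -
      have "map (count (\<rho> + reg m n)) cs = ys" using cnt[of "reg m n"] by simp
      then have "exec (compile f cs (m + 2) (m + 4)) (\<rho> + reg m n) (\<rho> + reg m n + reg (m + 2) (v 0))"
        using a(4) m(3) by (intro compilesD[OF PrimRec.IH(1)[OF v(1)]]) auto
      then show ?thesis by simp
    qed
    moreover have "exec [Loop m ?body] (?S n 0) (?S 0 n)" using loop[of 0 n] by simp
    moreover have "exec [Loop (m + 2) [Inc out]] (?S 0 n) (\<rho> + reg (m + 1) n + reg out y)"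
      using exec_move[of "m + 2" "\<rho> + reg (m + 1) n" out "v n"] a(3,4) v(3) by (auto simp: ac_simps)
    moreover have "exec [Loop (m + 1) []] (\<rho> + reg (m + 1) n + reg out y) (\<rho> + reg out y)"
      using exec_clear[of "m + 1" "\<rho> + reg out y" n] a(3,4) by (auto simp: ac_simps)
    ultimately show "exec (compile (PrimRec f g) ins out m) \<rho> (\<rho> + reg out y)"
      unfolding cs(1) compile.simps list.sel by - (assumption | rule exec_append exec_Cons2)+
  qed
next
  case (Mu f)
  then have f0: "rec_eval f (y # xs) 0" and "\<forall>i<y. \<exists>z. rec_eval f (i # xs) (Suc z)"
    by (auto elim: rec_MuE)
  then obtain w where w: "\<And>i. i < y \<Longrightarrow> rec_eval f (i # xs) (Suc (w i))" by metis
  \<comment> \<open>The positive values below \<open>y\<close> and the final zero in one sequence: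
    register \<open>m + 1\<close> holds \<open>v i\<close> when candidate \<open>i\<close> has been
    tested, and its being zero ends the loop.\<close>
  define v where "v i = (if i < y then Suc (w i) else 0)" for i
  have v: "rec_eval f (i # xs) (v i)" if "i \<le> y" for i
    using that f0 w by (cases "i = y") (auto simp: v_def)
  show ?case unfolding compiles_def
  proof (intro allI impI)
    fix ins out m and \<rho> :: "nat multiset"
    assume a: "map (count \<rho>) ins = xs" "\<forall>i\<in>set ins. i < m \<and> i \<noteq> out" "out < m" "\<forall>r\<ge>m. r \<notin># \<rho>"
    have m0: "count \<rho> m = 0" using a(4) by (simp add: count_eq_zero_iff)
    let ?C = "compile f (m # ins) (m + 1) (m + 2)"
    let ?body = "[Loop (m + 1) [], Inc m] @ ?C"
    have C: "exec ?C (\<rho> + reg m i) (\<rho> + reg m i + reg (m + 1) (v i))" if "i \<le> y" for i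
    proof -
      have "map (count (\<rho> + reg m i)) ins = xs" using a(1,2) by auto
      then show ?thesis
        using a(2,4) m0 by (intro compilesD[OF Mu.IH[OF v[OF that]]]) auto
    qed
    have loop: "i + d = y \<Longrightarrow> exec [Loop (m + 1) ?body] (\<rho> + reg m i + reg (m + 1) (v i)) (\<rho> + reg m y)" for i d
    proof (induction d arbitrary: i)
      case 0
      then show ?case using a(4) by (auto intro!: exec_Loop_exit simp: v_def split: if_splits)
    next
      case (Suc d)
      then have vi: "v i = Suc (w i)" by (simp add: v_def)
      have "exec [Loop (m + 1) []] (\<rho> + reg m i + reg (m + 1) (w i)) (\<rho> + reg m i)"
        using a(4) by (intro exec_clear) auto
      moreover have "exec [Inc m] (\<rho> + reg m i) (\<rho> + reg m (Suc i))"
        using exec_Inc[of m "\<rho> + reg m i"] by simp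
      moreover have "exec ?C (\<rho> + reg m (Suc i)) (\<rho> + reg m (Suc i) + reg (m + 1) (v (Suc i)))"
        using Suc.prems by (intro C) simp
      ultimately have "exec ?body (\<rho> + reg m i + reg (m + 1) (w i)) (\<rho> + reg m (Suc i) + reg (m + 1) (v (Suc i)))"
        by - (assumption | rule exec_append exec_Cons2)+
      moreover have "exec [Loop (m + 1) ?body] (\<rho> + reg m (Suc i) + reg (m + 1) (v (Suc i))) (\<rho> + reg m y)"
        by (rule Suc.IH) (use Suc.prems in simp)
      ultimately have "exec [Loop (m + 1) ?body] (add_mset (m + 1) (\<rho> + reg m i + reg (m + 1) (w i))) (\<rho> + reg m y)"
        by (rule exec_Loop_step)
      then show ?case by (simp add: vi)
    qed
    have "exec ?C \<rho> (\<rho> + reg (m + 1) (v 0))" using C[of 0] by simp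
    moreover have "exec [Loop (m + 1) ?body] (\<rho> + reg (m + 1) (v 0)) (\<rho> + reg m y)" using loop[of 0 y] by simp
    moreover have "exec [Loop m [Inc out]] (\<rho> + reg m y) (\<rho> + reg out y)"
      using a(3,4) by (intro exec_move) auto
    ultimately show "exec (compile (Mu f) ins out m) \<rho> (\<rho> + reg out y)"
      unfolding compile.simps by - (assumption | rule exec_append exec_Cons2)+
  qed
qed

section \<open>Phase semantics\<close>

text \<open>A phase space: a commutative monoid with a pole \<open>P\<close>. Formulas denote facts,
  the sets closed under the double orthogonal.\<close>

definition perp :: "'m::comm_monoid_add set \<Rightarrow> 'm set \<Rightarrow> 'm set" where
  "perp P X = {y. \<forall>x\<in>X. x + y \<in> P}"

definition cl :: "'m::comm_monoid_add set \<Rightarrow> 'm set \<Rightarrow> 'm set" where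
  "cl P X = perp P (perp P X)"

lemma cl_iff: "w \<in> cl P X \<longleftrightarrow> (\<forall>y. (\<forall>x\<in>X. x + y \<in> P) \<longrightarrow> w + y \<in> P)"
  unfolding cl_def perp_def by (auto simp: add.commute)

lemma subset_cl: "X \<subseteq> cl P X"
  by (auto simp: cl_iff)

lemma cl_mono: "X \<subseteq> Y \<Longrightarrow> cl P X \<subseteq> cl P Y"
  unfolding cl_iff subset_iff by blast

abbreviation is_fact :: "'m::comm_monoid_add set \<Rightarrow> 'm set \<Rightarrow> bool" where
  "is_fact P Z \<equiv> cl P Z \<subseteq> Z"

lemma fact_cl: "is_fact P (cl P X)"
proof
  fix w assume w: "w \<in> cl P (cl P X)"
  show "w \<in> cl P X"
    unfolding cl_iff
  proof (intro allI impI)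
    fix y assume "\<forall>x\<in>X. x + y \<in> P"
    then have "\<forall>x\<in>cl P X. x + y \<in> P" by (simp add: cl_iff)
    then show "w + y \<in> P" using w unfolding cl_iff[of w P "cl P X"] by blast
  qed
qed

lemma cl_least: "X \<subseteq> Z \<Longrightarrow> is_fact P Z \<Longrightarrow> cl P X \<subseteq> Z"
  using cl_mono[of X Z P] by (rule subset_trans)

text \<open>If \<open>y\<close> takes all of \<open>Z\<close> into the pole, then
  \<open>x + y\<close> takes all of the residual into the pole, and hence its closure.\<close>

lemma fact_residual:
  assumes "is_fact P Z"
  shows "is_fact P {z. \<forall>x\<in>X. x + z \<in> Z}"
proof (intro subsetI CollectI ballI)
  fix z x
  assume z: "z \<in> cl P {z. \<forall>x\<in>X. x + z \<in> Z}" and x: "x \<in> X"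
  have "x + z + y \<in> P" if y: "\<forall>x\<in>Z. x + y \<in> P" for y
  proof -
    have "\<forall>w\<in>{z. \<forall>x\<in>X. x + z \<in> Z}. w + (x + y) \<in> P"
    proof
      fix w assume "w \<in> {z. \<forall>x\<in>X. x + z \<in> Z}"
      then have "x + w + y \<in> P" using x y by blast
      then show "w + (x + y) \<in> P" by (simp add: ac_simps)
    qed
    then have "z + (x + y) \<in> P" using z by (auto simp: cl_iff)
    then show ?thesis by (simp add: ac_simps)
  qed
  then have "x + z \<in> cl P Z" by (simp add: cl_iff)
  then show "x + z \<in> Z" using assms by blast
qed

text \<open>The elimination principle for closures: to land in a fact, it suffices to check the
  generators.\<close>

lemma cl_add_left:
  assumes "is_fact P Z" "\<And>x. x \<in> X \<Longrightarrow> x + a \<in> Z" "x \<in> cl P X"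
  shows "x + a \<in> Z"
proof -
  have "X \<subseteq> {z. \<forall>x\<in>{a}. x + z \<in> Z}" using assms(2) by (auto simp: add.commute)
  from cl_least[OF this fact_residual[OF assms(1)]] show ?thesis
    using assms(3) by (auto simp: add.commute)
qed

section \<open>Interpretation of formulas and soundness\<close>

inductive_set stars :: "'m::comm_monoid_add set \<Rightarrow> 'm set" for X where
  stars_0: "0 \<in> stars X"
| stars_add: "x \<in> X \<Longrightarrow> y \<in> stars X \<Longrightarrow> x + y \<in> stars X"

text \<open>The star is the closure of all finite sums, its reading under the omega-rule. The
  induction rule is sound for it by induction on the number of summands.\<close>

primrec den :: "'m::comm_monoid_add set \<Rightarrow> (nat \<Rightarrow> 'm) \<Rightarrow> form \<Rightarrow> 'm set" where
  "den P v (Var n) = cl P {v n}"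
| "den P v Bot = cl P {}"
| "den P v One = cl P {0}"
| "den P v (Imp A B) = {z. \<forall>x\<in>den P v A. x + z \<in> den P v B}"
| "den P v (Tens A B) = cl P {x + y |x y. x \<in> den P v A \<and> y \<in> den P v B}"
| "den P v (Or A B) = cl P (den P v A \<union> den P v B)"
| "den P v (And A B) = den P v A \<inter> den P v B"
| "den P v (Star A) = cl P (stars (den P v A))"

lemma fact_den: "is_fact P (den P v A)"
proof (induction A)
  case (And A B)
  have "cl P (den P v A \<inter> den P v B) \<subseteq> cl P (den P v A)" "cl P (den P v A \<inter> den P v B) \<subseteq> cl P (den P v B)"
    by (simp_all add: cl_mono)
  from this[THEN subset_trans] And show ?case by simp
qed (simp_all add: fact_cl fact_residual)

lemma den_Tens_least:
  assumes "is_fact P Z" "\<And>x y. x \<in> den P v A \<Longrightarrow> y \<in> den P v B \<Longrightarrow> x + y \<in> Z"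
  shows "den P v (Tens A B) \<subseteq> Z"
  unfolding den.simps using assms(2) by (intro cl_least[OF _ assms(1)]) auto

lemma den_Tens_I: "x \<in> den P v A \<Longrightarrow> y \<in> den P v B \<Longrightarrow> x + y \<in> den P v (Tens A B)"
  unfolding den.simps by (rule subsetD[OF subset_cl]) blast

lemma zero_in_den_One: "0 \<in> den P v One"
  using subset_cl[of "{0}"] by auto

lemma den_One_add:
  assumes "x \<in> den P v One" "a \<in> den P v A"
  shows "x + a \<in> den P v A"
  using assms cl_add_left[OF fact_den, of "{0}" a P v A x] by simp

lemma stars_subset_den_Star: "stars (den P v A) \<subseteq> den P v (Star A)"
  by (simp add: subset_cl)

lemma leq_sound: "A \<preceq> B \<Longrightarrow> den P v A \<subseteq> den P v B"
proof (induction rule: leq.induct)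
  case (leq_mono A B C D)
  then show ?case by (intro den_Tens_least fact_den den_Tens_I) auto
next
  case (leq_comm A B)
  show ?case by (intro den_Tens_least fact_den) (subst add.commute, rule den_Tens_I)
next
  case (leq_assoc A B C)
  show ?case
  proof (intro den_Tens_least fact_den)
    fix x c assume x: "x \<in> den P v (Tens A B)" and c: "c \<in> den P v C"
    show "x + c \<in> den P v (Tens A (Tens B C))"
    proof (rule cl_add_left[OF fact_den _ x[unfolded den.simps]])
      fix z assume "z \<in> {x + y |x y. x \<in> den P v A \<and> y \<in> den P v B}"
      then obtain a b where z: "z = a + b" "a \<in> den P v A" "b \<in> den P v B" by blast
      show "z + c \<in> den P v (Tens A (Tens B C))"
        using den_Tens_I[OF z(2) den_Tens_I[OF z(3) c]] unfolding z(1) add.assoc .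
    qed
  qed
next
  case (leq_unit1 A)
  show ?case
  proof
    fix x assume "x \<in> den P v A"
    from den_Tens_I[OF zero_in_den_One this] show "x \<in> den P v (Tens One A)" by simp
  qed
next
  case (leq_unit2 A)
  show ?case by (intro den_Tens_least fact_den den_One_add)
next
  case (leq_app A B)
  show ?case by (intro den_Tens_least fact_den) auto
next
  case (leq_coapp B A)
  show ?case
  proof
    fix b assume "b \<in> den P v B"
    then have "\<forall>a\<in>den P v A. a + b \<in> den P v (Tens A B)" using den_Tens_I by blast
    then show "b \<in> den P v (Imp A (Tens A B))" by simp
  qed
next
  case (leq_Bot A)
  show ?case by (simp add: cl_least fact_den)
next
  case (leq_Or1 A B)
  then show ?case using subset_cl[of "den P v A \<union> den P v B"] by simp
next
  case (leq_Or2 B A)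
  then show ?case using subset_cl[of "den P v A \<union> den P v B"] by simp
next
  case (leq_OrL A C B)
  then show ?case by (simp add: cl_least fact_den)
next
  case (leq_Star0 A)
  show ?case using cl_mono[of "{0}" "stars (den P v A)" P] by (auto intro: stars_0)
next
  case (leq_StarS A)
  show ?case
  proof (intro den_Tens_least fact_den)
    fix x y assume x: "x \<in> den P v A" and y: "y \<in> den P v (Star A)"
    have "y + x \<in> den P v (Star A)"
    proof (rule cl_add_left[OF fact_den _ y[unfolded den.simps]])
      fix z assume "z \<in> stars (den P v A)"
      from stars_add[OF x this] show "z + x \<in> den P v (Star A)"
        using stars_subset_den_Star[of P v A] by (metis add.commute subsetD)
    qed
    then show "x + y \<in> den P v (Star A)" by (simp add: add.commute)
  qed
next
  case (leq_ind B A)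
  have "x \<in> den P v B" if "x \<in> stars (den P v A)" for x
    using that
  proof induction
    case stars_0
    show ?case by (rule subsetD[OF leq_ind.IH(1) zero_in_den_One])
  next
    case (stars_add x y)
    from den_Tens_I[OF stars_add(1) stars_add.IH] show ?case by (rule subsetD[OF leq_ind.IH(2)])
  qed
  then have "stars (den P v A) \<subseteq> den P v B" by blast
  then show ?case by (simp add: cl_least fact_den)
next
  case (leq_AndR C A B)
  then show ?case by simp
next
  case (leq_Imp A B C)
  then show ?case by (auto simp: subset_iff)
qed (blast | simp)+

section \<open>Encoding of register machines\<close>

text \<open>The remaining programs that a run can pass through. They are finitely many because a
  part of a loop body is always followed by that same loop, and this is what lets one finite formula
  describe the machine.\<close>

fun residuals :: "cmd list \<Rightarrow> cmd list set" where
  "residuals [] = {[]}"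
| "residuals (Inc r # k) = insert (Inc r # k) (residuals k)"
| "residuals (Loop r b # k) =
     insert (Loop r b # k) (residuals k \<union> (\<lambda>c. c @ Loop r b # k) ` residuals b)"

lemma finite_residuals: "finite (residuals p)"
  by (induction p rule: residuals.induct) auto

lemma self_in_residuals: "p \<in> residuals p"
  by (cases p rule: residuals.cases) auto

lemma step_append:
  assumes "step (d @ q, \<rho>) (c, \<rho>')" "d \<noteq> []"
  shows "\<exists>d'. c = d' @ q \<and> step (d, \<rho>) (d', \<rho>')"
proof -
  obtain x e where d: "d = x # e" using assms(2) by (cases d) auto
  show ?thesis
  proof (cases x)
    case (Inc r)
    then show ?thesis using assms(1) unfolding d by (auto elim: step.cases intro: step_Inc)
  next
    case (Loop r b)
    then consider \<rho>0 where "\<rho> = add_mset r \<rho>0" "c = (b @ Loop r b # e) @ q" "\<rho>' = \<rho>0"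
      | "r \<notin># \<rho>" "c = e @ q" "\<rho>' = \<rho>"
      using assms(1) unfolding d by (auto elim: step.cases)
    then show ?thesis unfolding d Loop by cases (blast intro: step_Loop step_Exit)+
  qed
qed

lemma step_residuals: "c \<in> residuals p \<Longrightarrow> step (c, \<rho>) (c', \<rho>') \<Longrightarrow> c' \<in> residuals p"
proof (induction p arbitrary: c c' \<rho> \<rho>' rule: residuals.induct)
  case 1
  then show ?case by (auto elim: step.cases)
next
  case (2 r k)
  then show ?case using self_in_residuals[of k] by (auto elim: step.cases)
next
  case (3 r b k)
  have L: "step (Loop r b # k, \<rho>) (c', \<rho>') \<Longrightarrow> ?case"
    using self_in_residuals[of k] self_in_residuals[of b] by (auto elim: step.cases)
  from "3.prems"(1) consider "c = Loop r b # k" | "c \<in> residuals k"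
    | d where "d \<in> residuals b" "c = d @ Loop r b # k" by auto
  then show ?case
  proof cases
    case 3
    show ?thesis
    proof (cases "d = []")
      case False
      with step_append[of d "Loop r b # k"] obtain d' where "c' = d' @ Loop r b # k" "step (d, \<rho>) (d', \<rho>')"
        using \<open>step (c, \<rho>) (c', \<rho>')\<close> 3 by blast
      then show ?thesis using "3.IH"(2) 3(1) by auto
    qed (use 3 \<open>step (c, \<rho>) (c', \<rho>')\<close> L in simp)
  qed (use "3.prems"(2) "3.IH"(1) L in auto)
qed

instance cmd :: countable
  by countable_datatype

datatype marker = St "cmd list" | Zr nat

instance marker :: countable
  by countable_datatype

text \<open>A configuration is represented by the multiset of its registers together with a marker,
  which is either the remaining program or, in the side branch that justifies leaving a loop, the
  claim that a register is \<open>0\<close>.\<close>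

definition reg_atom :: "nat \<Rightarrow> form" where "reg_atom r = Var (2 * r)"
definition mark_atom :: "marker \<Rightarrow> form" where "mark_atom m = Var (2 * to_nat m + 1)"

definition big_or :: "form list \<Rightarrow> form" where "big_or xs = foldr Or xs Bot"
definition big_and :: "form list \<Rightarrow> form \<Rightarrow> form" where "big_and xs A = foldr And xs A"

text \<open>The last implication can be applied whatever register \<open>r\<close> contains. A proof
  that applies it must also treat the branch with marker \<open>Zr r\<close>, and there a leftover
  \<open>r\<close> is fatal.\<close>

fun instrs :: "cmd list \<Rightarrow> form list" where
  "instrs [] = []"
| "instrs (Inc r # k) = [Imp (mark_atom (St (Inc r # k))) (Tens (reg_atom r) (mark_atom (St k)))]"
| "instrs (Loop r b # k) =
    [Imp (Tens (reg_atom r) (mark_atom (St (Loop r b # k)))) (mark_atom (St (b @ Loop r b # k))),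
     Imp (mark_atom (St (Loop r b # k))) (Or (mark_atom (St k)) (mark_atom (Zr r)))]"

text \<open>Lets the side branch of a zero test use up the remaining copies of the step formula
  without changing anything.\<close>

definition keep_zero :: "nat \<Rightarrow> form" where "keep_zero r = Imp (mark_atom (Zr r)) (mark_atom (Zr r))"

text \<open>The language has no constant for truth to end the conjunction; a harmless instruction
  takes its place.\<close>

definition step_form :: "cmd list list \<Rightarrow> nat \<Rightarrow> form" where
  "step_form Q N = big_and (concat (map instrs Q) @ map keep_zero [0..<N]) (keep_zero 0)"

text \<open>Here the star plays a second role: it absorbs an arbitrary multiset of the given
  registers.\<close>

definition some_regs :: "nat list \<Rightarrow> form" where
  "some_regs rs = Star (big_or (map reg_atom rs))"

text \<open>Every configuration proves it, so a run may be cut off anywhere. The disjunct for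
  \<open>Zr r\<close> leaves out exactly the register \<open>r\<close>.\<close>

definition goal_form :: "cmd list list \<Rightarrow> nat \<Rightarrow> form" where
  "goal_form Q N = big_or (map (\<lambda>k. Tens (mark_atom (St k)) (some_regs [0..<N])) Q @
     map (\<lambda>r. Tens (mark_atom (Zr r)) (some_regs (filter (\<lambda>s. s \<noteq> r) [0..<N]))) [0..<N])"

definition config :: "marker \<Rightarrow> nat multiset \<Rightarrow> form multiset" where
  "config m \<rho> = add_mset (mark_atom m) (image_mset reg_atom \<rho>)"

subsection \<open>Looping machines yield derivable sequents\<close>

lemma derivable_big_or: "A \<in> set xs \<Longrightarrow> \<Gamma> \<turnstile> A \<Longrightarrow> \<Gamma> \<turnstile> big_or xs"
  by (induction xs) (auto simp: big_or_def intro: derivable.intros)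

lemma derivable_big_and: "A \<in> set xs \<Longrightarrow> add_mset A \<Gamma> \<turnstile> C \<Longrightarrow> add_mset (big_and xs B) \<Gamma> \<turnstile> C"
  by (induction xs) (auto simp: big_and_def intro: derivable.intros)

lemma derivable_Star_add: "\<Gamma> \<turnstile> A \<Longrightarrow> \<Delta> \<turnstile> Star A \<Longrightarrow> \<Gamma> + \<Delta> \<turnstile> Star A"
proof -
  assume "\<Gamma> \<turnstile> A" "\<Delta> \<turnstile> Star A"
  have "{#Star A#} + \<Gamma> \<turnstile> Star A"
    by (rule Cut[OF \<open>\<Gamma> \<turnstile> A\<close>]) (use Star_Suc[of A] in simp)
  then have "add_mset (Star A) \<Gamma> \<turnstile> Star A" by simp
  from Cut[OF \<open>\<Delta> \<turnstile> Star A\<close> this] show ?thesis .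
qed

lemma derivable_some_regs: "set_mset \<rho> \<subseteq> set rs \<Longrightarrow> image_mset reg_atom \<rho> \<turnstile> some_regs rs"
proof (induction \<rho>)
  case empty
  then show ?case by (simp add: some_regs_def Star_0)
next
  case (add r \<rho>)
  have "{#reg_atom r#} \<turnstile> big_or (map reg_atom rs)"
    using add.prems by (intro derivable_big_or[of "reg_atom r"] Ax) auto
  from derivable_Star_add[OF this] add show ?case by (simp add: some_regs_def)
qed

lemma config_goal:
  assumes "set_mset \<rho> \<subseteq> {..<N}"
  shows "k \<in> set Q \<Longrightarrow> config (St k) \<rho> \<turnstile> goal_form Q N"
    and "r < N \<Longrightarrow> r \<notin># \<rho> \<Longrightarrow> config (Zr r) \<rho> \<turnstile> goal_form Q N"
proof -
  have T: "image_mset reg_atom \<rho> \<turnstile> B \<Longrightarrow> config m \<rho> \<turnstile> Tens (mark_atom m) B" for m B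
    using TensR[OF Ax[of "mark_atom m"]] by (simp add: config_def)
  show "k \<in> set Q \<Longrightarrow> config (St k) \<rho> \<turnstile> goal_form Q N"
    unfolding goal_form_def
    using assms by (rule_tac derivable_big_or[OF _ T[OF derivable_some_regs[of _ "[0..<N]"]]]) auto
  show "r < N \<Longrightarrow> r \<notin># \<rho> \<Longrightarrow> config (Zr r) \<rho> \<turnstile> goal_form Q N"
    unfolding goal_form_def
    using assms
    by (rule_tac derivable_big_or[OF _ T[OF derivable_some_regs[of _ "filter (\<lambda>s. s \<noteq> r) [0..<N]"]]]) auto
qed

text \<open>The induction rule admits no side formulas, so the invariant is moved to the right: the
  rule is applied with \<open>Imp J J\<close>.\<close>

lemma derivable_invariant:
  assumes "{#E, J#} \<turnstile> J"
  shows "{#Star E, J#} \<turnstile> J"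
proof -
  have "{#} \<turnstile> Imp J J" using Ax by (intro ImpR) simp
  moreover have "{#J, E, Imp J J#} \<turnstile> J"
    using ImpL[OF Ax[of J], of J "{#E#}" J] assms by (simp add: add_mset_commute)
  then have "{#E, Imp J J#} \<turnstile> Imp J J" by (rule ImpR)
  ultimately have "{#Star E#} \<turnstile> Imp J J" by (rule Star_ind)
  from Cut[OF this, of "{#J#}" J] derivable_app[of J J] show ?thesis by (simp add: add_mset_commute)
qed

text \<open>The formula \<open>Or One (Tens E (Star E))\<close> is itself closed under adding an
  \<open>E\<close>, so the induction rule derives it from \<open>Star E\<close>.\<close>

lemma derivable_Star_unfold:
  assumes "\<Gamma> \<turnstile> C" "add_mset E (add_mset (Star E) \<Gamma>) \<turnstile> C"
  shows "add_mset (Star E) \<Gamma> \<turnstile> C"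
proof -
  let ?U = "Or One (Tens E (Star E))"
  have "{#One, E#} \<turnstile> Tens E (Star E)"
    using TensR[OF Ax[of E] Star_0[of E]] by (intro OneL) simp
  moreover have "{#Tens E (Star E), E#} \<turnstile> Tens E (Star E)"
    using TensR'[OF Ax[of E] TensL'[OF Star_Suc[of E]]] by (simp add: add_mset_commute)
  ultimately have "{#E, ?U#} \<turnstile> ?U"
    using OrR2[OF OrL[of One "{#E#}"]] by (simp add: add_mset_commute)
  with Star_ind[OF OrR1[OF OneR]] have "{#Star E#} \<turnstile> ?U" by blast
  moreover have "add_mset ?U \<Gamma> \<turnstile> C"
    using assms by (intro OrL OneL TensL)
  ultimately show ?thesis using Cut by fastforce
qed

lemma derivable_step_form:
  assumes "A \<in> set (instrs c)" "c \<in> set Q" "add_mset A \<Gamma> \<turnstile> C"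
  shows "add_mset (step_form Q N) \<Gamma> \<turnstile> C"
  unfolding step_form_def by (rule derivable_big_and[OF _ assms(3)]) (use assms(1,2) in auto)

lemma ImpL_add: "\<Pi> \<turnstile> A \<Longrightarrow> add_mset B \<Gamma> \<turnstile> C \<Longrightarrow> add_mset (Imp A B) (\<Pi> + \<Gamma>) \<turnstile> C"
  using ImpL[of \<Pi> A B \<Gamma> C] by (simp add: add.commute)

text \<open>Read upwards, one copy of the step formula is spent on replacing a configuration by its
  successor; \<open>\<Delta>\<close> will be the star that remains.\<close>

lemma derivable_Inc:
  assumes "Inc r # k \<in> set Q" "\<Delta> + config (St k) (add_mset r \<rho>) \<turnstile> C"
  shows "add_mset (step_form Q N) (\<Delta> + config (St (Inc r # k)) \<rho>) \<turnstile> C"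
proof (rule derivable_step_form[OF _ assms(1)])
  have "add_mset (Tens (reg_atom r) (mark_atom (St k))) (\<Delta> + image_mset reg_atom \<rho>) \<turnstile> C"
    using assms(2) by (intro TensL) (simp add: config_def add_mset_commute)
  from ImpL_add[OF Ax[of "mark_atom (St (Inc r # k))"] this]
  show "add_mset (Imp (mark_atom (St (Inc r # k))) (Tens (reg_atom r) (mark_atom (St k)))) (\<Delta> + config (St (Inc r # k)) \<rho>) \<turnstile> C"
    by (simp add: config_def)
qed simp

lemma derivable_Loop:
  assumes "Loop r b # k \<in> set Q" "\<Delta> + config (St (b @ Loop r b # k)) \<rho> \<turnstile> C"
  shows "add_mset (step_form Q N) (\<Delta> + config (St (Loop r b # k)) (add_mset r \<rho>)) \<turnstile> C"
proof (rule derivable_step_form[OF _ assms(1)])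
  have "add_mset (mark_atom (St (b @ Loop r b # k))) (\<Delta> + image_mset reg_atom \<rho>) \<turnstile> C"
    using assms(2) by (simp add: config_def)
  from ImpL_add[OF TensR'[OF Ax[of "reg_atom r"] Ax[of "mark_atom (St (Loop r b # k))"]] this]
  show "add_mset (Imp (Tens (reg_atom r) (mark_atom (St (Loop r b # k)))) (mark_atom (St (b @ Loop r b # k))))
      (\<Delta> + config (St (Loop r b # k)) (add_mset r \<rho>)) \<turnstile> C"
    by (simp add: config_def add_mset_commute)
qed simp

lemma derivable_Exit:
  assumes "Loop r b # k \<in> set Q" "\<Delta> + config (St k) \<rho> \<turnstile> C" "\<Delta> + config (Zr r) \<rho> \<turnstile> C"
  shows "add_mset (step_form Q N) (\<Delta> + config (St (Loop r b # k)) \<rho>) \<turnstile> C"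
proof (rule derivable_step_form[OF _ assms(1)])
  have "add_mset (Or (mark_atom (St k)) (mark_atom (Zr r))) (\<Delta> + image_mset reg_atom \<rho>) \<turnstile> C"
    using assms(2,3) by (intro OrL) (simp_all add: config_def)
  from ImpL_add[OF Ax[of "mark_atom (St (Loop r b # k))"] this]
  show "add_mset (Imp (mark_atom (St (Loop r b # k))) (Or (mark_atom (St k)) (mark_atom (Zr r)))) (\<Delta> + config (St (Loop r b # k)) \<rho>) \<turnstile> C"
    by (simp add: config_def)
qed simp

text \<open>The marker alone is an invariant of \<open>keep_zero r\<close>, so the whole star
  disappears by \<open>derivable_invariant\<close>.\<close>

lemma derivable_Zr:
  assumes "r < N" "config (Zr r) \<rho> \<turnstile> C"
  shows "add_mset (Star (step_form Q N)) (config (Zr r) \<rho>) \<turnstile> C"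
proof -
  have "add_mset (keep_zero r) {#mark_atom (Zr r)#} \<turnstile> mark_atom (Zr r)"
    using ImpL_add[OF Ax[of "mark_atom (Zr r)"], of "mark_atom (Zr r)" "{#}"] Ax[of "mark_atom (Zr r)"] by (simp add: keep_zero_def)
  then have "{#step_form Q N, mark_atom (Zr r)#} \<turnstile> mark_atom (Zr r)"
    unfolding step_form_def by (rule derivable_big_and[rotated]) (use assms(1) in auto)
  from Cut[OF derivable_invariant[OF this], of "image_mset reg_atom \<rho>" C] assms(2)
  show ?thesis by (simp add: config_def)
qed

lemma derivable_tensL: "\<Delta> + mset l \<turnstile> C \<Longrightarrow> add_mset (tens l) \<Delta> \<turnstile> C"
proof (induction l arbitrary: \<Delta>)
  case (Cons A l)
  then have "add_mset (tens l) (add_mset A \<Delta>) \<turnstile> C" by (intro Cons.IH) simp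
  then show ?case by (simp add: TensL add_mset_commute)
qed (simp add: OneL)

text \<open>With \<open>r\<close> positive the run alternates between two configurations, before and
  after decrementing. Their disjunction is an invariant of the step formula, and each of them proves
  the goal.\<close>

lemma derivable_loop:
  assumes Q: "[Loop r [Inc r]] \<in> set Q" "[Inc r, Loop r [Inc r]] \<in> set Q" and \<rho>: "set_mset \<rho> \<subseteq> {..<N}" "r < N"
  shows "add_mset (Star (step_form Q N)) (config (St [Loop r [Inc r]]) (add_mset r \<rho>)) \<turnstile> goal_form Q N"
proof -
  let ?L = "St [Loop r [Inc r]]" and ?I = "St [Inc r, Loop r [Inc r]]"
  obtain l i where l: "mset l = config ?L (add_mset r \<rho>)" and i: "mset i = config ?I \<rho>" by (metis ex_mset)
  let ?J = "Or (tens l) (tens i)"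
  have J: "config ?L (add_mset r \<rho>) \<turnstile> ?J" "config ?I \<rho> \<turnstile> ?J"
    using derivable_tens[of l] derivable_tens[of i] by (simp_all add: l i OrR1 OrR2)
  have "add_mset (step_form Q N) ({#} + config ?L (add_mset r \<rho>)) \<turnstile> ?J"
    using J(2) by (intro derivable_Loop Q) simp
  moreover have "add_mset (step_form Q N) ({#} + config ?I \<rho>) \<turnstile> ?J"
    using J(1) by (intro derivable_Inc Q) simp
  ultimately have "add_mset ?J {#step_form Q N#} \<turnstile> ?J"
    by (intro OrL derivable_tensL) (simp_all add: l i)
  then have "{#Star (step_form Q N), ?J#} \<turnstile> ?J"
    by (intro derivable_invariant) (simp add: add_mset_commute)
  moreover have "{#?J#} \<turnstile> goal_form Q N"
    by (intro OrL derivable_tensL) (use Q \<rho> in \<open>auto simp: l i intro!: config_goal\<close>)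
  ultimately have "{#Star (step_form Q N), ?J#} \<turnstile> goal_form Q N" by (rule derivable_cut)
  with Cut[OF J(1), of "{#Star (step_form Q N)#}" "goal_form Q N"]
  show ?thesis by (simp add: add_mset_commute)
qed

fun register :: "cmd list \<Rightarrow> nat" where
  "register [] = 0"
| "register (Inc r # k) = r"
| "register (Loop r b # k) = r"

text \<open>Unfolding the star leaves two cases: with no step to make, the configuration itself
  proves the goal; otherwise one copy of the step formula simulates the step. On leaving a loop the
  side branch is closed by \<open>derivable_Zr\<close>.\<close>

lemma derivable_step:
  assumes "step (c, \<rho>) (c', \<rho>')" "c \<in> set Q" "register c < N" "set_mset \<rho> \<subseteq> {..<N}"
    "add_mset (Star (step_form Q N)) (config (St c') \<rho>') \<turnstile> goal_form Q N"
  shows "add_mset (Star (step_form Q N)) (config (St c) \<rho>) \<turnstile> goal_form Q N"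
proof (rule derivable_Star_unfold)
  show "config (St c) \<rho> \<turnstile> goal_form Q N" using assms by (intro config_goal)
  have "add_mset (step_form Q N) ({#Star (step_form Q N)#} + config (St c) \<rho>) \<turnstile> goal_form Q N"
    using assms(1)
  proof cases
    case (step_Inc r)
    then show ?thesis using assms(2,5) derivable_Inc[of r c' Q "{#Star (step_form Q N)#}" \<rho>] by simp
  next
    case (step_Loop r b k)
    then show ?thesis using assms(2,5) derivable_Loop[of r b k Q "{#Star (step_form Q N)#}" \<rho>'] by simp
  next
    case (step_Exit r b)
    then have "add_mset (Star (step_form Q N)) (config (Zr r) \<rho>) \<turnstile> goal_form Q N"
      using assms(3,4) by (intro derivable_Zr config_goal) auto
    then show ?thesis using step_Exit assms(2,5) derivable_Exit[of r b c' Q "{#Star (step_form Q N)#}" \<rho>] by simp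
  qed
  then show "add_mset (step_form Q N) (add_mset (Star (step_form Q N)) (config (St c) \<rho>)) \<turnstile> goal_form Q N"
    by simp
qed

lemma derivable_steps:
  assumes "step\<^sup>*\<^sup>* s t" and Q: "set Q = residuals p" "\<And>c. c \<in> set Q \<Longrightarrow> register c < N"
    and "fst s \<in> set Q" "set_mset (snd s) \<subseteq> {..<N}"
    and "fst t = [Loop r [Inc r]]" "r \<in># snd t"
  shows "add_mset (Star (step_form Q N)) (config (St (fst s)) (snd s)) \<turnstile> goal_form Q N"
  using assms
proof (induction rule: converse_rtranclp_induct)
  case base
  obtain \<rho> where \<rho>: "snd t = add_mset r \<rho>" using base(6) by (metis insert_DiffM)
  have "[Inc r] @ [Loop r [Inc r]] \<in> set Q"
    using step_residuals[OF _ step_Loop[of r "[Inc r]" "[]" \<rho>], of p] base(1,3,5) by simp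
  then show ?case using base(3-) \<rho> by (auto intro: derivable_loop)
next
  case (step s u)
  obtain c \<rho> c' \<rho>' where su: "s = (c, \<rho>)" "u = (c', \<rho>')" by (metis surj_pair)
  have c': "c' \<in> set Q" using step_residuals step.hyps(1) step.prems(1,3) unfolding su by auto
  have "set_mset \<rho>' \<subseteq> {..<N}"
    using step.hyps(1)[unfolded su] step.prems(2)[of c] step.prems(3,4) unfolding su
    by cases auto
  then show ?case using step.hyps(1) step.IH step.prems c' unfolding su by (auto intro: derivable_step)
qed

subsection \<open>Derivable sequents come from machines that do not halt\<close>

definition atom_val :: "nat \<Rightarrow> nat \<times> marker multiset \<times> nat multiset" where
  "atom_val n = (if even n then (0, {#}, {#n div 2#}) else (0, {#from_nat (n div 2)#}, {#}))"

text \<open>The first component counts the tokens that license a machine step.\<close>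

definition runs :: "(nat \<times> marker multiset \<times> nat multiset) set" where
  "runs = {(n, {#St k#}, \<rho>) |n k \<rho>. \<exists>c. (step ^^ n) (k, \<rho>) c} \<union> {(n, {#Zr r#}, \<rho>) |n r \<rho>. r \<notin># \<rho>}"

abbreviation "val \<equiv> den runs atom_val"
abbreviation token :: "nat \<Rightarrow> nat \<times> marker multiset \<times> nat multiset" where "token n \<equiv> (n, {#}, {#})"

lemma atom_val_simps [simp]: "atom_val (2 * r) = (0, {#}, {#r#})" "atom_val (Suc (2 * to_nat m)) = (0, {#m#}, {#})"
  by (simp_all add: atom_val_def)

lemma val_atoms: "val (reg_atom r) = cl runs {(0, {#}, {#r#})}" "val (mark_atom m) = cl runs {(0, {#m#}, {#})}"
  by (simp_all add: reg_atom_def mark_atom_def)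

lemma val_R: "(0, {#}, {#r#}) \<in> val (reg_atom r)" and val_M: "(0, {#m#}, {#}) \<in> val (mark_atom m)"
  unfolding val_atoms using subset_cl by blast+

lemma St_in_runs [simp]: "(n, {#St k#}, \<rho>) \<in> runs \<longleftrightarrow> (\<exists>c. (step ^^ n) (k, \<rho>) c)"
  by (auto simp: runs_def)

lemma Zr_in_runs [simp]: "(n, {#Zr r#}, \<rho>) \<in> runs \<longleftrightarrow> r \<notin># \<rho>"
  by (auto simp: runs_def)

lemma runs_marker: "(n, add_mset m A, \<rho>) \<in> runs \<Longrightarrow> A = {#}"
  by (auto simp: runs_def)

text \<open>A token pays for one step. This backward closure of the pole is what makes every
  instruction true at a single token.\<close>

lemma runs_step: "(n, {#St k'#}, \<rho>') \<in> runs \<Longrightarrow> step (k, \<rho>) (k', \<rho>') \<Longrightarrow> (Suc n, {#St k#}, \<rho>) \<in> runs"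
  unfolding St_in_runs by (blast intro: relpowp_Suc_I2)

text \<open>Elements of the pole carry exactly one marker, so a context completing an element that
  has one contributes only tokens and registers.\<close>

lemma in_cl_runs:
  assumes "(0, {#m'#}, \<sigma>) \<in> X"
    and "\<And>n \<rho>. \<forall>x\<in>X. x + (n, {#}, \<rho>) \<in> runs \<Longrightarrow> (i + n, {#m#}, \<tau> + \<rho>) \<in> runs"
  shows "(i, {#m#}, \<tau>) \<in> cl runs X"
  unfolding cl_iff
proof (intro allI impI)
  fix y assume y: "\<forall>x\<in>X. x + y \<in> runs"
  obtain n A \<rho> where yeq: "y = (n, A, \<rho>)" by (cases y) auto
  from y assms(1) have "(0, {#m'#}, \<sigma>) + y \<in> runs" by blast
  then have "A = {#}" using runs_marker[of n m' A "\<sigma> + \<rho>"] by (simp add: yeq)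
  then show "(i, {#m#}, \<tau>) + y \<in> runs" using assms(2)[of n \<rho>] y by (simp add: yeq)
qed

lemma token_Imp_atom:
  assumes "(1, {#m#}, {#}) \<in> val B"
  shows "token 1 \<in> val (Imp (mark_atom m) B)"
proof -
  have "x + token 1 \<in> val B" if x: "x \<in> val (mark_atom m)" for x
    by (rule cl_add_left[OF fact_den _ x[unfolded val_atoms]]) (use assms in simp)
  then show ?thesis unfolding den.simps(4) by blast
qed

lemma token_Imp_Tens:
  assumes "(1, {#m#}, {#r#}) \<in> val B"
  shows "token 1 \<in> val (Imp (Tens (reg_atom r) (mark_atom m)) B)"
proof -
  have "val (Tens (reg_atom r) (mark_atom m)) \<subseteq> {z. \<forall>a\<in>{token 1}. a + z \<in> val B}"
  proof (rule den_Tens_least[OF fact_residual[OF fact_den]])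
    fix x y assume x: "x \<in> val (reg_atom r)" and y: "y \<in> val (mark_atom m)"
    have "y + (token 1 + (0, {#}, {#r#})) \<in> val B"
      by (rule cl_add_left[OF fact_den _ y[unfolded val_atoms]]) (use assms in simp)
    then have "(0, {#}, {#r#}) + (token 1 + y) \<in> val B" by (simp only: ac_simps)
    then have "x + (token 1 + y) \<in> val B"
      by (intro cl_add_left[OF fact_den _ x[unfolded val_atoms]]) simp
    moreover have "x + (token 1 + y) = token 1 + (x + y)" by (rule add.left_commute)
    ultimately show "x + y \<in> {z. \<forall>a\<in>{token 1}. a + z \<in> val B}" by simp
  qed
  then have "token 1 + x \<in> val B" if "x \<in> val (Tens (reg_atom r) (mark_atom m))" for x using that by blast
  then have "x + token 1 \<in> val B" if "x \<in> val (Tens (reg_atom r) (mark_atom m))" for x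
    using that by (subst add.commute)
  then show ?thesis unfolding den.simps(4)[of _ _ _ B] by blast
qed

lemma token_instr: "A \<in> set (instrs c) \<Longrightarrow> token 1 \<in> val A"
proof (induction c rule: instrs.induct)
  case (2 r k)
  have "(1, {#St (Inc r # k)#}, {#}) \<in> cl runs {(0, {#St k#}, {#r#})}"
    by (rule in_cl_runs) (auto simp del: St_in_runs intro: runs_step step_Inc)
  also have "\<dots> \<subseteq> val (Tens (reg_atom r) (mark_atom (St k)))"
    using den_Tens_I[OF val_R[of r] val_M[of "St k"]] by (intro cl_least[OF _ fact_den]) simp
  finally have "token 1 \<in> val (Imp (mark_atom (St (Inc r # k))) (Tens (reg_atom r) (mark_atom (St k))))"
    by (rule token_Imp_atom)
  with 2 show ?case by (simp del: den.simps)
next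
  case (3 r b k)
  have "(1, {#St (Loop r b # k)#}, {#r#}) \<in> val (mark_atom (St (b @ Loop r b # k)))"
    unfolding val_atoms
    by (rule in_cl_runs) (auto simp del: St_in_runs intro: runs_step step_Loop)
  then have loop: "token 1 \<in> val (Imp (Tens (reg_atom r) (mark_atom (St (Loop r b # k)))) (mark_atom (St (b @ Loop r b # k))))"
    by (rule token_Imp_Tens)
  \<comment> \<open>A context that completes both branches contains no \<open>r\<close>, because it
    takes \<open>Zr r\<close> into the pole; leaving the loop is therefore a legal step
    there.\<close>
  have "(1, {#St (Loop r b # k)#}, {#}) \<in> cl runs {(0, {#St k#}, {#}), (0, {#Zr r#}, {#})}"
    by (rule in_cl_runs[of "St k" "{#}"]) (auto simp del: St_in_runs intro: runs_step step_Exit)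
  also have "\<dots> \<subseteq> val (Or (mark_atom (St k)) (mark_atom (Zr r)))"
    unfolding den.simps using val_M[of "St k"] val_M[of "Zr r"] by (intro cl_mono) simp
  finally have "token 1 \<in> val (Imp (mark_atom (St (Loop r b # k))) (Or (mark_atom (St k)) (mark_atom (Zr r))))"
    by (rule token_Imp_atom)
  with 3 loop show ?case by (auto simp del: den.simps)
qed simp

lemma token_keep_zero: "token 1 \<in> val (keep_zero r)"
proof -
  have "(1, {#Zr r#}, {#}) \<in> val (mark_atom (Zr r))"
    unfolding val_atoms by (rule in_cl_runs) auto
  then show ?thesis unfolding keep_zero_def by (rule token_Imp_atom)
qed

lemma token_step_form: "token 1 \<in> val (step_form Q N)"
proof -
  have "(\<And>A. A \<in> set xs \<Longrightarrow> token 1 \<in> val A) \<Longrightarrow> token 1 \<in> val B \<Longrightarrow> token 1 \<in> val (big_and xs B)" for xs B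
    by (induction xs) (simp_all add: big_and_def)
  then show ?thesis unfolding step_form_def
  proof this
    fix A assume "A \<in> set (concat (map instrs Q) @ map keep_zero [0..<N])"
    then consider c where "A \<in> set (instrs c)" | r where "A = keep_zero r" by auto
    then show "token 1 \<in> val A" by cases (simp_all only: token_instr token_keep_zero)
  qed (rule token_keep_zero)
qed

lemma tokens_Star: "token n \<in> val (Star (step_form Q N))"
proof -
  have "token n \<in> stars (val (step_form Q N))"
  proof (induction n)
    case 0
    show ?case using stars_0[of "val (step_form Q N)"] by (simp add: zero_prod_def)
  next
    case (Suc n)
    from stars_add[OF token_step_form this] show ?case by simp
  qed
  then show ?thesis using stars_subset_den_Star by blast
qed

lemma fact_runs: "is_fact runs runs"
proof
  fix w assume "w \<in> cl runs runs"
  then have "(\<forall>x\<in>runs. x + 0 \<in> runs) \<longrightarrow> w + 0 \<in> runs" unfolding cl_iff by (rule spec)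
  then show "w \<in> runs" by simp
qed

lemma big_or_least: "is_fact runs Z \<Longrightarrow> (\<And>A. A \<in> set xs \<Longrightarrow> val A \<subseteq> Z) \<Longrightarrow> val (big_or xs) \<subseteq> Z"
proof (induction xs)
  case Nil
  from cl_least[OF empty_subsetI Nil(1)] show ?case by (simp add: big_or_def)
next
  case (Cons A xs)
  then have "val A \<union> val (big_or xs) \<subseteq> Z" by simp
  from cl_least[OF this Cons.prems(1)] show ?case by (simp add: big_or_def)
qed

text \<open>The set \<open>?Y\<close> absorbs every register in \<open>rs\<close>, hence so does its
  closure, and it contains the empty sum.\<close>

lemma val_some_regs: "val (some_regs rs) \<subseteq> cl runs {(0, {#}, \<rho>) |\<rho>. set_mset \<rho> \<subseteq> set rs}" (is "_ \<subseteq> cl _ ?Y")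
proof -
  let ?B = "big_or (map reg_atom rs)"
  have reg: "val (reg_atom r) \<subseteq> {z. \<forall>y\<in>cl runs ?Y. y + z \<in> cl runs ?Y}" if "r \<in> set rs" for r
    unfolding val_atoms
  proof (rule cl_least[OF _ fact_residual[OF fact_cl]], intro subsetI CollectI ballI)
    fix z y assume z: "z \<in> {(0::nat, {#} :: marker multiset, {#r#})}" and y: "y \<in> cl runs ?Y"
    show "y + z \<in> cl runs ?Y"
    proof (rule cl_add_left[OF fact_cl _ y])
      fix x assume "x \<in> ?Y"
      then have "x + z \<in> ?Y" using z that by auto
      then show "x + z \<in> cl runs ?Y" by (rule subsetD[OF subset_cl])
    qed
  qed
  have B: "val ?B \<subseteq> {z. \<forall>y\<in>cl runs ?Y. y + z \<in> cl runs ?Y}"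
    by (rule big_or_least[OF fact_residual[OF fact_cl]]) (use reg in auto)
  have "x \<in> cl runs ?Y" if "x \<in> stars (val ?B)" for x
    using that
  proof induction
    case stars_0
    have "0 \<in> ?Y" by (simp add: zero_prod_def)
    then show ?case by (rule subsetD[OF subset_cl])
  next
    case (stars_add x y)
    from subsetD[OF B stars_add(1)] stars_add.IH have "y + x \<in> cl runs ?Y" by (simp only: mem_Collect_eq)
    then show ?case by (simp only: add.commute)
  qed
  then have "stars (val ?B) \<subseteq> cl runs ?Y" by blast
  from cl_least[OF this fact_cl] show ?thesis by (simp add: some_regs_def)
qed

lemma val_ImpD: "z \<in> val (Imp A B) \<Longrightarrow> x \<in> val A \<Longrightarrow> x + z \<in> val B"
  by simp

text \<open>Without tokens there is no step to make, so every configuration lies in the pole, and so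
  does \<open>Zr r\<close> in the absence of \<open>r\<close>.\<close>

lemma val_goal_form: "val (goal_form Q N) \<subseteq> runs"
proof -
  have *: "val (Tens (mark_atom m) (some_regs rs)) \<subseteq> runs"
    if "\<And>\<rho>. set_mset \<rho> \<subseteq> set rs \<Longrightarrow> (0, {#m#}, \<rho>) \<in> runs" for m rs
  proof (rule den_Tens_least[OF fact_runs])
    fix x y assume x: "x \<in> val (mark_atom m)" and "y \<in> val (some_regs rs)"
    then have y: "y \<in> cl runs {(0, {#}, \<rho>) |\<rho>. set_mset \<rho> \<subseteq> set rs}" using val_some_regs by blast
    have "y + (0, {#m#}, {#}) \<in> runs"
      by (rule cl_add_left[OF fact_runs _ y]) (use that in auto)
    then show "x + y \<in> runs"
      by (intro cl_add_left[OF fact_runs _ x[unfolded val_atoms]]) (simp add: add.commute)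
  qed
  show ?thesis
    unfolding goal_form_def
  proof (rule big_or_least[OF fact_runs])
    fix A assume "A \<in> set (map (\<lambda>k. Tens (mark_atom (St k)) (some_regs [0..<N])) Q @
     map (\<lambda>r. Tens (mark_atom (Zr r)) (some_regs (filter (\<lambda>s. s \<noteq> r) [0..<N]))) [0..<N])"
    then consider k where "A = Tens (mark_atom (St k)) (some_regs [0..<N])"
      | r where "A = Tens (mark_atom (Zr r)) (some_regs (filter (\<lambda>s. s \<noteq> r) [0..<N]))" by auto
    then show "val A \<subseteq> runs"
    proof cases
      case 1
      show ?thesis unfolding 1 by (rule *) simp
    next
      case 2
      show ?thesis unfolding 2 by (rule *) auto
    qed
  qed
qed

subsection \<open>The sequent of a machine\<close>

text \<open>The reduction uses the formula of one fixed machine, whose code enters it as a constant;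
  an unspecified choice of \<open>Q\<close> and \<open>N\<close> therefore suffices.
  \<open>0 < N\<close> covers the input register.\<close>

definition machine_form :: "cmd list \<Rightarrow> form" where
  "machine_form p = (let Q = SOME Q. set Q = residuals p; N = SOME N. 0 < N \<and> (\<forall>c\<in>residuals p. register c < N)
     in Imp (mark_atom (St p)) (Imp (Star (step_form Q N)) (goal_form Q N)))"

lemma machine_form:
  obtains Q N where "machine_form p = Imp (mark_atom (St p)) (Imp (Star (step_form Q N)) (goal_form Q N))"
    "set Q = residuals p" "0 < N" "\<And>c. c \<in> residuals p \<Longrightarrow> register c < N"
proof -
  have "set (SOME Q. set Q = residuals p) = residuals p"
    by (rule someI_ex) (rule finite_list[OF finite_residuals])
  moreover have "\<exists>N. 0 < N \<and> (\<forall>c\<in>residuals p. register c < N)"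
    using finite_residuals[of p] finite_nat_set_iff_bounded[of "insert 0 (register ` residuals p)"] by auto
  from someI_ex[OF this]
  have "0 < (SOME N. 0 < N \<and> (\<forall>c\<in>residuals p. register c < N))"
    "\<forall>c\<in>residuals p. register c < (SOME N. 0 < N \<and> (\<forall>c\<in>residuals p. register c < N))"
    by blast+
  ultimately show ?thesis using that unfolding machine_form_def Let_def by blast
qed

definition input_form :: "nat \<Rightarrow> form" where
  "input_form n = tens (replicate n (reg_atom 0))"

lemma looping_derivable:
  assumes "step\<^sup>*\<^sup>* (p, reg 0 n) ([Loop r [Inc r]], \<rho>)" "r \<in># \<rho>"
  shows "{#} \<turnstile> Imp (input_form n) (machine_form p)"
proof -
  obtain Q N where QN: "machine_form p = Imp (mark_atom (St p)) (Imp (Star (step_form Q N)) (goal_form Q N))"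
    "set Q = residuals p" "0 < N" "\<And>c. c \<in> residuals p \<Longrightarrow> register c < N"
    by (rule machine_form) blast
  have "add_mset (Star (step_form Q N)) (config (St p) (reg 0 n)) \<turnstile> goal_form Q N"
    using derivable_steps[OF assms(1) QN(2), of N r] assms(2) QN self_in_residuals[of p] by auto
  then have "mset (replicate n (reg_atom 0)) \<turnstile> machine_form p"
    unfolding QN(1) by (intro ImpR) (simp add: config_def)
  then show ?thesis
    unfolding input_form_def by (intro ImpR derivable_tensL) simp
qed

text \<open>Validity at \<open>k\<close> tokens yields a run of \<open>k\<close> steps from the
  initial configuration, for every \<open>k\<close>. By determinism, a long enough run would have to
  continue from the empty program.\<close>

lemma halting_not_derivable:
  assumes "step\<^sup>*\<^sup>* (p, reg 0 n) ([], \<rho>)"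
  shows "\<not> {#} \<turnstile> Imp (input_form n) (machine_form p)"
proof
  assume der: "{#} \<turnstile> Imp (input_form n) (machine_form p)"
  obtain Q N where Q: "machine_form p = Imp (mark_atom (St p)) (Imp (Star (step_form Q N)) (goal_form Q N))"
    by (rule machine_form) blast
  from der have "One \<preceq> Imp (input_form n) (machine_form p)" using derivable_mset_iff[of "[]"] by simp
  then have 0: "0 \<in> val (Imp (input_form n) (machine_form p))" using leq_sound zero_in_den_One by blast
  have "(0, {#}, reg 0 n) \<in> val (input_form n)"
    unfolding input_form_def
  proof (induction n)
    case 0
    show ?case using zero_in_den_One[of runs atom_val] by (simp add: zero_prod_def)
  next
    case (Suc n)
    from den_Tens_I[OF val_R[of 0] this] show ?case by simp
  qed
  from val_ImpD[OF 0 this] have "(0, {#}, reg 0 n) \<in> val (machine_form p)" by simp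
  from val_ImpD[OF this[unfolded Q] val_M]
  have p: "(0, {#St p#}, reg 0 n) \<in> val (Imp (Star (step_form Q N)) (goal_form Q N))" by simp
  have "(k, {#St p#}, reg 0 n) \<in> runs" for k
    using subsetD[OF val_goal_form val_ImpD[OF p tokens_Star[of k]]] by simp
  then have all: "\<exists>c. (step ^^ k) (p, reg 0 n) c" for k by simp
  obtain k where k: "(step ^^ k) (p, reg 0 n) ([], \<rho>)" using assms rtranclp_imp_relpowp by metis
  from all[of "Suc k"] obtain d e where "(step ^^ k) (p, reg 0 n) d" "step d e" by auto
  moreover have "(step ^^ k) c d \<Longrightarrow> (step ^^ k) c e \<Longrightarrow> d = e" for c d e
  proof (induction k arbitrary: d e)
    case (Suc k)
    then obtain d' e' where "(step ^^ k) c d'" "step d' d" "(step ^^ k) c e'" "step e' e" by auto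
    with Suc.IH[of d' e'] show ?case using step_deterministic by blast
  qed simp
  ultimately have "step ([], \<rho>) e" using k by metis
  then show False by (auto elim: step.cases)
qed

section \<open>Completeness\<close>

lemma decidable_compose: "decidable P \<Longrightarrow> computable f \<Longrightarrow> decidable (\<lambda>x. P (f x))"
  unfolding decidable_def by (rule computable_compose)

text \<open>Gives a program that reports \<open>d\<close> about the least witness; below,
  \<open>d\<close> tells which of the two searches has succeeded.\<close>

lemma search_compose:
  assumes "decidable P" "computable d"
  obtains g where "\<And>n t. P (pair t n) \<Longrightarrow> \<forall>m<t. \<not> P (pair m n) \<Longrightarrow> rec_eval g [n] (d (pair t n))"
proof -
  obtain f where f: "\<And>x y. rec_eval f [x] y \<longleftrightarrow> P (pair y x) \<and> (\<forall>m<y. \<not> P (pair m x))"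
    using minimization[OF assms(1)] by blast
  have "total_recf 2 (\<lambda>ys. pair (ys ! 0) (ys ! 1))"
    by (intro total_pair total_proj) simp_all
  from total_comp1[OF assms(2) this] obtain r where
    r: "\<And>ys. length ys = 2 \<Longrightarrow> rec_eval r ys (d (pair (ys ! 0) (ys ! 1)))"
    unfolding total_recf_def by blast
  have "rec_eval (Comp r [f, Proj 0]) [n] (d (pair t n))" if "P (pair t n)" "\<forall>m<t. \<not> P (pair m n)" for n t
  proof (rule rec_Comp)
    show "list_all2 (\<lambda>g y. rec_eval g [n] y) [f, Proj 0] [t, n]"
      using that f rec_Proj[of 0 "[n]"] by simp
    show "rec_eval r [t, n] (d (pair t n))" using r[of "[t, n]"] by simp
  qed
  then show ?thesis using that by blast
qed

text \<open>The code of the sequent with input \<open>n\<close> of the machine whose formula has the code \<open>e\<close>.\<close>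

definition machine_code :: "nat \<Rightarrow> nat \<Rightarrow> nat" where
  "machine_code e n = pair 0 (pair 3 (pair (rec_nat (pair 2 0) (\<lambda>_ c. pair 4 (pair (pair 0 0) c)) n) e))"

text \<open>The leading \<open>0\<close> is the empty antecedent, and \<open>pair 0 0\<close> is the
  code of \<open>reg_atom 0\<close>, that is, of \<open>Var 0\<close>.\<close>

lemma machine_code: "machine_code (form_code A) n = sequent_code ({#}, Imp (input_form n) A)"
proof -
  have "rec_nat (pair 2 0) (\<lambda>_ c. pair 4 (pair (pair 0 0) c)) n = form_code (input_form n)"
    by (induction n) (simp_all add: input_form_def reg_atom_def)
  then show ?thesis by (simp add: machine_code_def sequent_code_def)
qed

lemma computable_machine_code: "computable f \<Longrightarrow> computable g \<Longrightarrow> computable (\<lambda>x. machine_code (f x) (g x))"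
  unfolding machine_code_def by (intro comp_intros computable_rec_nat computable_id)

text \<open>The final loop turns output into behaviour: it is left at once if register 1 is
  \<open>0\<close> and runs forever otherwise.\<close>

lemma compiled_machine:
  assumes "rec_eval g [n] y"
  shows "step\<^sup>*\<^sup>* (compile g [0] 1 2 @ [Loop 1 [Inc 1]], reg 0 n) ([Loop 1 [Inc 1]], reg 0 n + reg 1 y)"
proof -
  have "exec (compile g [0] 1 2) (reg 0 n) (reg 0 n + reg 1 y)"
    by (rule compilesD[OF compile_correct[OF assms]]) auto
  then show ?thesis unfolding exec_def by blast
qed

theorem theorem11:
  shows "Sigma01_complete (sequent_code ` CommACT_theorems)"
  unfolding Sigma01_complete_def
proof (intro conjI allI impI)
  let ?T = "sequent_code ` CommACT_theorems"
  show re: "recursively_enumerable ?T" by (rule CommACT_theorems_re)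
  fix B assume "recursively_enumerable B"
  then obtain PB where PB: "decidable PB" "\<And>x. x \<in> B \<longleftrightarrow> (\<exists>t. PB (pair t x))"
    unfolding recursively_enumerable_iff by blast
  obtain PT where PT: "decidable PT" "\<And>s. s \<in> ?T \<longleftrightarrow> (\<exists>t. PT (pair t s))"
    using re unfolding recursively_enumerable_iff by blast
  define accept where "accept = (\<lambda>p. PB (pair (pfst p) (psnd (psnd p))))"
  \<comment> \<open>\<open>P\<close> is fixed before the machine that searches for it; the code of
    the formula is left open as the first half of the input.\<close>
  define P where "P = (\<lambda>p. PT (pair (pfst p) (machine_code (pfst (psnd p)) (psnd p))) \<or> accept p)"
  have accept: "decidable accept" unfolding accept_def
    by (intro decidable_compose[OF PB(1)] comp_intros computable_id)
  have P: "decidable P" unfolding P_def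
    by (intro decidable_disj accept decidable_compose[OF PT(1)] computable_machine_code comp_intros computable_id)
  have "computable (\<lambda>p. of_bool (accept p))" using accept by (simp add: decidable_def)
  from search_compose[OF P this] obtain g where
    g: "\<And>n t. P (pair t n) \<Longrightarrow> \<forall>m<t. \<not> P (pair m n) \<Longrightarrow> rec_eval g [n] (of_bool (accept (pair t n)))"
    by blast
  define p where "p = compile g [0] 1 2 @ [Loop 1 [Inc 1]]"
  define e where "e = form_code (machine_form p)"
  define h where "h x = machine_code e (pair e x)" for x
  have h: "h x \<in> ?T \<longleftrightarrow> {#} \<turnstile> Imp (input_form (pair e x)) (machine_form p)" for x
    using inj_image_mem_iff[OF inj_sequent_code] by (simp add: h_def e_def machine_code CommACT_theorems_def)
  have P_iff: "P (pair t (pair e x)) \<longleftrightarrow> PT (pair t (h x)) \<or> PB (pair t x)" for t x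
    by (simp add: P_def accept_def h_def)
  \<comment> \<open>The least \<open>t\<close> determines the outcome, and a tie counts as
    acceptance. The second alternative contradicts \<open>PT(2)\<close>, so a successful search
    leaves only the first.\<close>
  have run: "\<exists>t. PB (pair t x) \<and> h x \<in> ?T \<or> \<not> PB (pair t x) \<and> PT (pair t (h x)) \<and> h x \<notin> ?T"
    if ex: "\<exists>t. P (pair t (pair e x))" for x
  proof -
    let ?n = "pair e x"
    obtain t where t: "P (pair t ?n)" "\<forall>m<t. \<not> P (pair m ?n)"
      using ex exists_least_iff[of "\<lambda>t. P (pair t ?n)"] by blast
    have steps: "step\<^sup>*\<^sup>* (p, reg 0 ?n) ([Loop 1 [Inc 1]], reg 0 ?n + reg 1 (of_bool (PB (pair t x))))"
      using compiled_machine[OF g[OF t]] by (simp add: p_def accept_def)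
    show ?thesis
    proof (cases "PB (pair t x)")
      case True
      then have "h x \<in> ?T" using looping_derivable[OF steps] h by simp
      with True show ?thesis by blast
    next
      case False
      then have "step\<^sup>*\<^sup>* (p, reg 0 ?n) ([Loop 1 [Inc 1]], reg 0 ?n)" using steps by simp
      moreover have "step ([Loop 1 [Inc 1]], reg 0 ?n) ([], reg 0 ?n)" by (rule step_Exit) simp
      ultimately have "step\<^sup>*\<^sup>* (p, reg 0 ?n) ([], reg 0 ?n)" by (rule rtranclp.rtrancl_into_rtrancl)
      from halting_not_derivable[OF this] have "h x \<notin> ?T" using h by simp
      moreover have "PT (pair t (h x))" using False t(1) P_iff by blast
      ultimately show ?thesis using False by blast
    qed
  qed
  have "x \<in> B \<longleftrightarrow> h x \<in> ?T" for x
  proof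
    assume "x \<in> B"
    then have "\<exists>t. P (pair t (pair e x))" using PB(2) P_iff by blast
    from run[OF this] show "h x \<in> ?T" using PT(2) by blast
  next
    assume T: "h x \<in> ?T"
    then have "\<exists>t. P (pair t (pair e x))" using PT(2) P_iff by blast
    from run[OF this] T show "x \<in> B" using PB(2) by blast
  qed
  moreover have "computable h"
    unfolding h_def by (intro computable_machine_code comp_intros computable_id)
  ultimately show "many_one_reducible B ?T" unfolding many_one_reducible_def by blast
qed

end
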